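(* Let $M$ be an $n$-dimensional compact minimal submanifold of the unit sphere $S^{n+m}$, let $S=(a_{\alpha\beta})$ be its fundamental matrix, and for an integer $p\ge 2$ let $f_p=\mathrm{Tr}(S^p)$. Let $x\in M$, and choose the local orthonormal frames so that $S$ is diagonal at $x$, with $a_{\alpha\beta}=\lambda_\alpha\delta_{\alpha\beta}$ at $x$ (so $\lambda_\alpha=\|A^\alpha\|^2$). Then at $x$, $$\frac{1}{2p}\Delta f_p=\frac12\sum_{s+t=p-2}\ \sum_{k,\alpha,\beta}\lambda_\alpha^s\lambda_\beta^t\,(D_k a_{\alpha\beta})^2+\sum_\alpha\Big(\lambda_\alpha^{p-1}\sum_{i,j,k}(h^\alpha_{ijk})^2\Big)+n f_p-f_{p+1}-\sum_{\beta\ne\alpha}\|[A^\beta,A^\alpha]\|^2\,\lambda_\alpha^{p-1},$$ where the first sum is over integers $s,t\ge 0$ with $s+t=p-2$ and the last sum is over ordered pairs $(\alpha,\beta)$ with $\alpha\neq\beta$.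
   Context: Indices: $1\le i,j,k,l\le n$ are tangential and $n+1\le\alpha,\beta,\gamma\le n+m$ are normal; repeated indices in the formulas below are summed. Let $\omega_1,\dots,\omega_{n+m}$ be a local orthonormal coframe of $S^{n+m}$ along $M$ with $\omega_1,\dots,\omega_n$ tangential to $M$ and $\omega_{n+1},\dots,\omega_{n+m}$ normal, and with connection forms $\omega_{AB}=-\omega_{BA}$ given by $d\omega_A=-\omega_{AB}\wedge\omega_B$. Let $e_1,\dots,e_n$ be the tangent frame dual to $\omega_1,\dots,\omega_n$. The second fundamental form has entries $h^\alpha_{ij}=h^\alpha_{ji}$ defined on $M$ by $\omega_{\alpha i}=h^\alpha_{ij}\omega_j$; minimality means $\sum_i h^\alpha_{ii}=0$ for all $\alpha$. The symmetric matrix $(h^\alpha_{ij})_{i,j}$ is denoted $A^\alpha$. The covariant derivative $h^\alpha_{ijk}$ is defined by $$h^\alpha_{ijk}\omega_k=dh^\alpha_{ij}-h^\alpha_{il}\omega_{lj}-h^\alpha_{lj}\omega_{li}+h^\beta_{ij}\omega_{\alpha\beta}.$$ For matrices, $\langle A,B\rangle=\sum_{i,j}a_{ij}b_{ij}$, $\|A\|^2=\langle A,A\rangle$, $[A,B]=AB-BA$. The fundamental matrix of $M$ is the $m\times m$ matrix-valued function $S=(a_{\alpha\beta})$, $a_{\alpha\beta}=\langle A^\alpha,A^\beta\rangle$. Its covariant derivative in the direction $e_k$ is $$D_k a_{\alpha\beta}=da_{\alpha\beta}(e_k)+\omega_{\alpha\gamma}(e_k)a_{\gamma\beta}+\omega_{\beta\gamma}(e_k)a_{\alpha\gamma}.$$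 $\Delta$ is the Laplace-Beltrami operator of $M$ (trace of the Hessian). The convention $0^0=1$ is used. *)

theory Defs
  imports "HOL-Analysis.Analysis"
begin

section \<open>Calculus on open subsets of Euclidean spaces\<close>

primrec Ck_on :: "nat \<Rightarrow> 'a::euclidean_space set \<Rightarrow> ('a \<Rightarrow> 'b::euclidean_space) \<Rightarrow> bool" where
  "Ck_on 0 U f \<longleftrightarrow> continuous_on U f"
| "Ck_on (Suc k) U f \<longleftrightarrow>
     (\<forall>x\<in>U. f differentiable at x) \<and> (\<forall>v. Ck_on k U (\<lambda>x. frechet_derivative f (at x) v))"

definition smooth_on :: "'a::euclidean_space set \<Rightarrow> ('a \<Rightarrow> 'b::euclidean_space) \<Rightarrow> bool" where
  "smooth_on U f \<longleftrightarrow> open U \<and> (\<forall>k. Ck_on k U f)"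

definition partial :: "'n::finite \<Rightarrow> (real^'n \<Rightarrow> 'b::real_normed_vector) \<Rightarrow> real^'n \<Rightarrow> 'b" where
  "partial i f q = frechet_derivative f (at q) (axis i 1)"

text \<open>A differential form is a function of the base point followed by its vector arguments.\<close>

definition ext_deriv ::
    "('e::euclidean_space \<Rightarrow> 'e \<Rightarrow> real) \<Rightarrow> 'e \<Rightarrow> 'e \<Rightarrow> 'e \<Rightarrow> real" where
  "ext_deriv \<theta> y X Y = frechet_derivative (\<lambda>z. \<theta> z Y) (at y) X
                    - frechet_derivative (\<lambda>z. \<theta> z X) (at y) Y"

definition wedge ::
    "('e \<Rightarrow> 'e \<Rightarrow> real) \<Rightarrow> ('e \<Rightarrow> 'e \<Rightarrow> real) \<Rightarrow> 'e \<Rightarrow> 'e \<Rightarrow> 'e \<Rightarrow> real" where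
  "wedge \<theta> \<eta> y X Y = \<theta> y X * \<eta> y Y - \<theta> y Y * \<eta> y X"

primrec matrix_pow :: "real^'k^'k \<Rightarrow> nat \<Rightarrow> real^'k^'k" where
  "matrix_pow A 0 = mat 1"
| "matrix_pow A (Suc p) = A ** matrix_pow A p"

definition commutator :: "real^'k^'k \<Rightarrow> real^'k^'k \<Rightarrow> real^'k^'k" where
  "commutator A B = A ** B - B ** A"


section \<open>Immersed submanifolds of the unit sphere\<close>

text \<open>
  A submanifold is a Hausdorff space \<open>M\<close> with a map \<open>F\<close> into Euclidean space that is a smooth
  immersion in local parametrizations \<open>\<phi>\<close>. Transition maps between such parametrizations are
  automatically smooth, because \<open>F \<circ> \<phi>\<close> is locally an embedding; hence no separate atlas is
  needed. Embedded submanifolds are the case where \<open>M\<close> is a subset of the sphere and \<open>F\<close>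
  the identity.
\<close>

definition local_param ::
    "'p::t2_space set \<Rightarrow> ('p \<Rightarrow> 'e::euclidean_space) \<Rightarrow> (real^'n) set \<Rightarrow> (real^'n \<Rightarrow> 'p) \<Rightarrow> bool" where
  "local_param M F V \<phi> \<longleftrightarrow>
     open V \<and> openin (top_of_set M) (\<phi> ` V) \<and> (\<exists>\<psi>. homeomorphism V (\<phi> ` V) \<phi> \<psi>) \<and>
     smooth_on V (F \<circ> \<phi>) \<and> (\<forall>q\<in>V. inj (frechet_derivative (F \<circ> \<phi>) (at q)))"

definition sphere_submanifold ::
    "'n::finite itself \<Rightarrow> 'p::t2_space set \<Rightarrow> ('p \<Rightarrow> 'e::euclidean_space) \<Rightarrow> bool" where
  "sphere_submanifold _ M F \<longleftrightarrow>
     F ` M \<subseteq> sphere 0 1 \<and>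
     (\<forall>x\<in>M. \<exists>(V :: (real^'n) set) \<phi>. local_param M F V \<phi> \<and> x \<in> \<phi> ` V)"

text \<open>The differential \<open>du\<close> at \<open>x \<in> \<phi> ` V\<close> on a vector \<open>X\<close> tangent to the immersed manifold,
  i.e. \<open>X\<close> lies in the range of the derivative of \<open>F \<circ> \<phi>\<close>.\<close>

definition tdiff ::
    "('p \<Rightarrow> 'e::euclidean_space) \<Rightarrow> (real^'n) set \<Rightarrow> (real^'n \<Rightarrow> 'p) \<Rightarrow> ('p \<Rightarrow> real) \<Rightarrow> 'p \<Rightarrow> 'e \<Rightarrow> real" where
  "tdiff F V \<phi> u x X =
     (let q = inv_into V \<phi> x
      in frechet_derivative (u \<circ> \<phi>) (at q) (inv (frechet_derivative (F \<circ> \<phi>) (at q)) X))"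


section \<open>The Laplace--Beltrami operator\<close>

text \<open>In local coordinates: induced metric, Christoffel symbols
  \<open>\<Gamma>\<^sup>k\<^sub>i\<^sub>j\<close>, covariant Hessian and its metric trace.\<close>

definition metric :: "(real^'n \<Rightarrow> 'e::euclidean_space) \<Rightarrow> real^'n \<Rightarrow> real^'n^'n" where
  "metric g q = (\<chi> i j. partial i g q \<bullet> partial j g q)"

definition christoffel ::
    "(real^'n \<Rightarrow> 'e::euclidean_space) \<Rightarrow> 'n \<Rightarrow> 'n \<Rightarrow> 'n \<Rightarrow> real^'n \<Rightarrow> real" where
  "christoffel g k i j q =
     (\<Sum>l\<in>UNIV. matrix_inv (metric g q) $ k $ l *
        (partial i (\<lambda>z. metric g z $ j $ l) q + partial j (\<lambda>z. metric g z $ i $ l) q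
         - partial l (\<lambda>z. metric g z $ i $ j) q)) / 2"

definition hessian ::
    "(real^'n \<Rightarrow> 'e::euclidean_space) \<Rightarrow> (real^'n \<Rightarrow> real) \<Rightarrow> real^'n \<Rightarrow> real^'n^'n" where
  "hessian g u q =
     (\<chi> i j. partial i (partial j u) q - (\<Sum>k\<in>UNIV. christoffel g k i j q * partial k u q))"

definition laplace_beltrami ::
    "('p \<Rightarrow> 'e::euclidean_space) \<Rightarrow> (real^'n) set \<Rightarrow> (real^'n \<Rightarrow> 'p) \<Rightarrow> ('p \<Rightarrow> real) \<Rightarrow> 'p \<Rightarrow> real" where
  "laplace_beltrami F V \<phi> u x =
     (let q = inv_into V \<phi> x
      in \<Sum>i\<in>UNIV. \<Sum>j\<in>UNIV. matrix_inv (metric (F \<circ> \<phi>) q) $ i $ j * hessian (F \<circ> \<phi>) (u \<circ> \<phi>) q $ i $ j)"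


section \<open>Adapted orthonormal frames and connection forms\<close>

text \<open>
  Frame indices have type \<open>'n + 'm\<close>: \<open>Inl i\<close> is tangential and \<open>Inr \<alpha>\<close> is normal.
  A frame \<open>E\<close> of the sphere is given by smooth vector fields on an open set \<open>W\<close> of the ambient
  space, only their values on the sphere being constrained.
\<close>

definition sphere_frame :: "'e::euclidean_space set \<Rightarrow> ('k::finite \<Rightarrow> 'e \<Rightarrow> 'e) \<Rightarrow> bool" where
  "sphere_frame W E \<longleftrightarrow>
     (\<forall>A. smooth_on W (E A)) \<and>
     (\<forall>y\<in>W \<inter> sphere 0 1. (\<forall>A. E A y \<bullet> y = 0) \<and>
        (\<forall>A B. E A y \<bullet> E B y = (if A = B then 1 else 0)))"

definition coframe :: "('k \<Rightarrow> 'e::euclidean_space \<Rightarrow> 'e) \<Rightarrow> 'k \<Rightarrow> 'e \<Rightarrow> 'e \<Rightarrow> real" where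
  "coframe E A y X = E A y \<bullet> X"

text \<open>
  The structure equations \<open>d\<omega>\<^sub>A = - \<omega>\<^sub>A\<^sub>B \<and> \<omega>\<^sub>B\<close> on the sphere. Exterior derivatives commute with
  restriction to the sphere, so \<open>ext_deriv\<close> of the coframe extended to \<open>W\<close>, evaluated on vectors
  tangent to the sphere, is independent of the extension.
\<close>

definition connection_forms ::
    "'e::euclidean_space set \<Rightarrow> ('k::finite \<Rightarrow> 'e \<Rightarrow> 'e) \<Rightarrow> ('k \<Rightarrow> 'k \<Rightarrow> 'e \<Rightarrow> 'e \<Rightarrow> real) \<Rightarrow> bool" where
  "connection_forms W E \<omega> \<longleftrightarrow>
     (\<forall>y\<in>W \<inter> sphere 0 1.
        (\<forall>A B. linear (\<omega> A B y)) \<and>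
        (\<forall>A B X. X \<bullet> y = 0 \<longrightarrow> \<omega> A B y X = - \<omega> B A y X) \<and>
        (\<forall>A X Y. X \<bullet> y = 0 \<longrightarrow> Y \<bullet> y = 0 \<longrightarrow>
           ext_deriv (coframe E A) y X Y = - (\<Sum>B\<in>UNIV. wedge (\<omega> A B) (coframe E B) y X Y)))"

definition adapted_frame ::
    "'p::t2_space set \<Rightarrow> ('p \<Rightarrow> 'e::euclidean_space) \<Rightarrow> (real^'n) set \<Rightarrow> (real^'n \<Rightarrow> 'p) \<Rightarrow>
     'e set \<Rightarrow> ('n + 'm::finite \<Rightarrow> 'e \<Rightarrow> 'e) \<Rightarrow> ('n + 'm \<Rightarrow> 'n + 'm \<Rightarrow> 'e \<Rightarrow> 'e \<Rightarrow> real) \<Rightarrow> bool" where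
  "adapted_frame M F V \<phi> W E \<omega> \<longleftrightarrow>
     local_param M F V \<phi> \<and> F ` \<phi> ` V \<subseteq> W \<and> sphere_frame W E \<and> connection_forms W E \<omega> \<and>
     (\<forall>q\<in>V. (\<forall>i. E (Inl i) (F (\<phi> q)) \<in> range (frechet_derivative (F \<circ> \<phi>) (at q))) \<and>
            (\<forall>\<alpha> v. E (Inr \<alpha>) (F (\<phi> q)) \<bullet> frechet_derivative (F \<circ> \<phi>) (at q) v = 0))"


section \<open>Second fundamental form, minimality and fundamental matrix\<close>

text \<open>\<open>\<omega>\<^sub>\<alpha>\<^sub>i = h\<^sup>\<alpha>\<^sub>i\<^sub>j \<omega>\<^sub>j\<close> on \<open>M\<close>, i.e. \<open>h\<^sup>\<alpha>\<^sub>i\<^sub>j = \<omega>\<^sub>\<alpha>\<^sub>i(e\<^sub>j)\<close>.\<close>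

definition sff ::
    "('p \<Rightarrow> 'e::euclidean_space) \<Rightarrow> ('n + 'm \<Rightarrow> 'e \<Rightarrow> 'e) \<Rightarrow>
     ('n + 'm \<Rightarrow> 'n + 'm \<Rightarrow> 'e \<Rightarrow> 'e \<Rightarrow> real) \<Rightarrow> 'm \<Rightarrow> 'n \<Rightarrow> 'n \<Rightarrow> 'p \<Rightarrow> real" where
  "sff F E \<omega> \<alpha> i j x = \<omega> (Inr \<alpha>) (Inl i) (F x) (E (Inl j) (F x))"

definition minimal ::
    "'n::finite itself \<Rightarrow> 'm::finite itself \<Rightarrow> 'p::t2_space set \<Rightarrow> ('p \<Rightarrow> 'e::euclidean_space) \<Rightarrow> bool" where
  "minimal _ _ M F \<longleftrightarrow>
     (\<forall>(V :: (real^'n) set) \<phi> W (E :: 'n + 'm \<Rightarrow> 'e \<Rightarrow> 'e) \<omega>. adapted_frame M F V \<phi> W E \<omega> \<longrightarrow>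
        (\<forall>x\<in>\<phi> ` V. \<forall>\<alpha>. (\<Sum>i\<in>UNIV. sff F E \<omega> \<alpha> i i x) = 0))"

definition shape_matrix ::
    "('p \<Rightarrow> 'e::euclidean_space) \<Rightarrow> ('n::finite + 'm \<Rightarrow> 'e \<Rightarrow> 'e) \<Rightarrow>
     ('n + 'm \<Rightarrow> 'n + 'm \<Rightarrow> 'e \<Rightarrow> 'e \<Rightarrow> real) \<Rightarrow> 'm \<Rightarrow> 'p \<Rightarrow> real^'n^'n" where
  "shape_matrix F E \<omega> \<alpha> x = (\<chi> i j. sff F E \<omega> \<alpha> i j x)"

text \<open>The inner product and norm of type \<open>real^'n^'n\<close> are the Frobenius ones.\<close>

definition fund_matrix ::
    "('p \<Rightarrow> 'e::euclidean_space) \<Rightarrow> ('n::finite + 'm::finite \<Rightarrow> 'e \<Rightarrow> 'e) \<Rightarrow>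
     ('n + 'm \<Rightarrow> 'n + 'm \<Rightarrow> 'e \<Rightarrow> 'e \<Rightarrow> real) \<Rightarrow> 'p \<Rightarrow> real^'m^'m" where
  "fund_matrix F E \<omega> x = (\<chi> \<alpha> \<beta>. shape_matrix F E \<omega> \<alpha> x \<bullet> shape_matrix F E \<omega> \<beta> x)"

text \<open>\<open>h\<^sup>\<alpha>\<^sub>i\<^sub>j\<^sub>k \<omega>\<^sub>k = dh\<^sup>\<alpha>\<^sub>i\<^sub>j - h\<^sup>\<alpha>\<^sub>i\<^sub>l \<omega>\<^sub>l\<^sub>j - h\<^sup>\<alpha>\<^sub>l\<^sub>j \<omega>\<^sub>l\<^sub>i + h\<^sup>\<beta>\<^sub>i\<^sub>j \<omega>\<^sub>\<alpha>\<^sub>\<beta>\<close>, evaluated on \<open>e\<^sub>k\<close>.\<close>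

definition cov_sff ::
    "('p \<Rightarrow> 'e::euclidean_space) \<Rightarrow> (real^'n) set \<Rightarrow> (real^'n \<Rightarrow> 'p) \<Rightarrow>
     ('n::finite + 'm::finite \<Rightarrow> 'e \<Rightarrow> 'e) \<Rightarrow> ('n + 'm \<Rightarrow> 'n + 'm \<Rightarrow> 'e \<Rightarrow> 'e \<Rightarrow> real) \<Rightarrow>
     'm \<Rightarrow> 'n \<Rightarrow> 'n \<Rightarrow> 'n \<Rightarrow> 'p \<Rightarrow> real" where
  "cov_sff F V \<phi> E \<omega> \<alpha> i j k x =
     (let e\<^sub>k = E (Inl k) (F x) in
        tdiff F V \<phi> (sff F E \<omega> \<alpha> i j) x e\<^sub>k
        - (\<Sum>l\<in>UNIV. sff F E \<omega> \<alpha> i l x * \<omega> (Inl l) (Inl j) (F x) e\<^sub>k)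
        - (\<Sum>l\<in>UNIV. sff F E \<omega> \<alpha> l j x * \<omega> (Inl l) (Inl i) (F x) e\<^sub>k)
        + (\<Sum>\<beta>\<in>UNIV. sff F E \<omega> \<beta> i j x * \<omega> (Inr \<alpha>) (Inr \<beta>) (F x) e\<^sub>k))"

definition cov_fund_matrix ::
    "('p \<Rightarrow> 'e::euclidean_space) \<Rightarrow> (real^'n) set \<Rightarrow> (real^'n \<Rightarrow> 'p) \<Rightarrow>
     ('n::finite + 'm::finite \<Rightarrow> 'e \<Rightarrow> 'e) \<Rightarrow> ('n + 'm \<Rightarrow> 'n + 'm \<Rightarrow> 'e \<Rightarrow> 'e \<Rightarrow> real) \<Rightarrow>
     'n \<Rightarrow> 'm \<Rightarrow> 'm \<Rightarrow> 'p \<Rightarrow> real" where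
  "cov_fund_matrix F V \<phi> E \<omega> k \<alpha> \<beta> x =
     (let e\<^sub>k = E (Inl k) (F x) in
        tdiff F V \<phi> (\<lambda>y. fund_matrix F E \<omega> y $ \<alpha> $ \<beta>) x e\<^sub>k
        + (\<Sum>\<gamma>\<in>UNIV. \<omega> (Inr \<alpha>) (Inr \<gamma>) (F x) e\<^sub>k * fund_matrix F E \<omega> x $ \<gamma> $ \<beta>)
        + (\<Sum>\<gamma>\<in>UNIV. \<omega> (Inr \<beta>) (Inr \<gamma>) (F x) e\<^sub>k * fund_matrix F E \<omega> x $ \<alpha> $ \<gamma>))"

text \<open>The trace does not depend on the adapted frame, so the local functions \<open>f\<^sub>p\<close> of different
  frames agree on overlaps.\<close>

definition fp ::
    "('p \<Rightarrow> 'e::euclidean_space) \<Rightarrow> ('n::finite + 'm::finite \<Rightarrow> 'e \<Rightarrow> 'e) \<Rightarrow>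
     ('n + 'm \<Rightarrow> 'n + 'm \<Rightarrow> 'e \<Rightarrow> 'e \<Rightarrow> real) \<Rightarrow> nat \<Rightarrow> 'p \<Rightarrow> real" where
  "fp F E \<omega> p x = trace (matrix_pow (fund_matrix F E \<omega> x) p)"

end

theory Submission
  imports Defs
begin

text \<open>
  The proof is Simons' computation carried out in a moving frame. Pulled back to the parameter
  domain, the frame consists of functions \<open>\<epsilon>\<^sub>A\<close> with values in the ambient Euclidean space, and
  the frame vectors \<open>e\<^sub>k\<close> become vector fields \<open>X\<^sub>k\<close>. Writing \<open>d\<^sub>k\<close> for the derivative along \<open>X\<^sub>k\<close>,
  the structure equations force \<open>\<omega>\<^sub>A\<^sub>B(e\<^sub>k) = \<epsilon>\<^sub>A \<bullet> d\<^sub>k \<epsilon>\<^sub>B\<close> (\<open>connection_forms_eq\<close>), so all data of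
  the theorem are functions of matrices of such products: the tangential connection \<open>t\<^sub>k\<close>, the
  normal connection \<open>\<nu>\<^sub>k\<close> and the second fundamental form \<open>h\<close>.

  The second derivatives of the vector-valued functions \<open>\<epsilon>\<^sub>A\<close> commute up to the brackets of the
  \<open>X\<^sub>k\<close>. The components of this one fact are the equations of Codazzi, Gauss and Ricci
  (\<open>structure_equation\<close>), and from the last two follows the commutation rule for covariant
  derivatives (\<open>ricci_identity\<close>). By Codazzi the first covariant derivative of \<open>h\<close> is totally
  symmetric, so in the trace of the second derivative one may exchange the order of
  differentiation and arrive at the derivative of the mean curvature, which vanishes. What remains
  is the curvature term of the exchange, and it is an algebraic expression in \<open>h\<close>:
  \<open>\<Delta>h\<^sup>\<alpha> = n h\<^sup>\<alpha> - \<Sum>\<^sub>\<beta> \<langle>h\<^sup>\<alpha>,h\<^sup>\<beta>\<rangle> h\<^sup>\<beta> - \<Sum>\<^sub>\<beta> [h\<^sup>\<beta>,[h\<^sup>\<beta>,h\<^sup>\<alpha>]]\<close> (\<open>simons_identity\<close>).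

  The covariant derivative of the fundamental matrix \<open>S\<close> is a derivation of the matrix product
  that differs from \<open>d\<^sub>k\<close> by a commutator, which the trace does not see. Hence
  \<open>d\<^sub>k Tr S\<^sup>p = p Tr (S\<^sup>p\<^sup>-\<^sup>1 D\<^sub>kS)\<close>, and a second differentiation gives one term with two factors
  \<open>D\<^sub>kS\<close>, which at a point where \<open>S\<close> is diagonal is the first sum of the theorem, and one with
  \<open>\<Delta>S\<close>, which by the product rule consists of \<open>\<bar>\<nabla>h\<bar>\<^sup>2\<close> and of the pairing of \<open>\<Delta>h\<close> with \<open>h\<close>
  (\<open>laplacian_trace_power\<close>). Finally the coordinate expression of the Laplace--Beltrami operator
  agrees with the frame expression used in this computation
  (\<open>laplace_beltrami_coordinates\<close>).
\<close>

section \<open>Smooth functions on open sets\<close>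

lemma frechet_derivative_bilinear:
  assumes "bounded_bilinear B" "f differentiable at q" "g differentiable at q"
  shows "frechet_derivative (\<lambda>z. B (f z) (g z)) (at q) v
       = B (f q) (frechet_derivative g (at q) v) + B (frechet_derivative f (at q) v) (g q)"
  using frechet_derivative_at[OF bounded_bilinear.FDERIV[OF assms(1)
      assms(2,3)[unfolded frechet_derivative_works]], symmetric] by simp

lemma frechet_derivative_linear:
  assumes "bounded_linear L" "f differentiable at q"
  shows "frechet_derivative (\<lambda>z. L (f z)) (at q) v = L (frechet_derivative f (at q) v)"
  using frechet_derivative_at[OF bounded_linear.has_derivative[OF assms(1)
      assms(2)[unfolded frechet_derivative_works]], symmetric] by simp

lemma frechet_derivative_plus:
  assumes "f differentiable at q" "g differentiable at q"
  shows "frechet_derivative (\<lambda>z. f z + g z) (at q) v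
       = frechet_derivative f (at q) v + frechet_derivative g (at q) v"
  using frechet_derivative_at[OF has_derivative_add[OF assms[unfolded frechet_derivative_works]],
      symmetric] by simp

lemma frechet_derivative_sum:
  assumes "\<And>i. i \<in> I \<Longrightarrow> f i differentiable at q"
  shows "frechet_derivative (\<lambda>z. \<Sum>i\<in>I. f i z) (at q) v = (\<Sum>i\<in>I. frechet_derivative (f i) (at q) v)"
  using frechet_derivative_at[OF has_derivative_sum[of I f "\<lambda>i. frechet_derivative (f i) (at q)"],
      symmetric] assms by (simp add: frechet_derivative_works)

lemma frechet_derivative_cong_open:
  assumes "open U" "q \<in> U" "\<And>z. z \<in> U \<Longrightarrow> f z = g z"
  shows "frechet_derivative f (at q) = frechet_derivative g (at q)"
proof -
  have "(f has_derivative f') (at q) \<longleftrightarrow> (g has_derivative f') (at q)" for f'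
    using assms by (metis has_derivative_transform_within_open)
  then show ?thesis by (simp add: frechet_derivative_def)
qed

lemma differentiable_cong_open:
  assumes "open U" "q \<in> U" "\<And>z. z \<in> U \<Longrightarrow> f z = g z" "f differentiable at q"
  shows "g differentiable at q"
  using assms unfolding differentiable_def by (metis has_derivative_transform_within_open)

lemma differentiable_bilinear:
  assumes "bounded_bilinear B" "f differentiable at q" "g differentiable at q"
  shows "(\<lambda>z. B (f z) (g z)) differentiable at q"
  using bounded_bilinear.FDERIV[OF assms(1) assms(2,3)[unfolded frechet_derivative_works]]
  by (auto simp: differentiable_def)

lemma differentiable_linear:
  assumes "bounded_linear L" "f differentiable at q"
  shows "(\<lambda>z. L (f z)) differentiable at q"
  using bounded_linear.has_derivative[OF assms(1) assms(2)[unfolded frechet_derivative_works]]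
  by (auto simp: differentiable_def)

lemma frechet_derivative_expand:
  fixes f :: "'a::euclidean_space \<Rightarrow> 'b::real_normed_vector"
  assumes "f differentiable at q"
  shows "frechet_derivative f (at q) v = (\<Sum>b\<in>Basis. (v \<bullet> b) *\<^sub>R frechet_derivative f (at q) b)"
proof -
  interpret linear "frechet_derivative f (at q)" by (rule linear_frechet_derivative[OF assms])
  show ?thesis
    by (subst (1) euclidean_representation[of v, symmetric]) (simp only: sum scale)
qed

lemma Ck_on_cong:
  assumes "open U" "\<And>z. z \<in> U \<Longrightarrow> f z = g z" "Ck_on k U f"
  shows "Ck_on k U g"
  using assms
proof (induction k arbitrary: f g)
  case 0
  then show ?case using continuous_on_cong[of U U f g] by auto
next
  case (Suc k)
  have "Ck_on k U (\<lambda>x. frechet_derivative g (at x) v)" for v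
    by (rule Suc.IH[of "\<lambda>x. frechet_derivative f (at x) v"])
      (use Suc.prems frechet_derivative_cong_open[of U _ f g] in auto)
  then show ?case
    using Suc.prems differentiable_cong_open[of U _ f g] by auto
qed

lemma Ck_on_lower:
  assumes "Ck_on (Suc k) U f"
  shows "Ck_on k U f"
  using assms
proof (induction k arbitrary: f)
  case 0
  then show ?case
    by (auto intro!: continuous_at_imp_continuous_on differentiable_imp_continuous_within)
qed auto

lemma Ck_on_const: "Ck_on k U (\<lambda>z. c)"
  by (induction k arbitrary: c) auto

lemma Ck_on_add:
  assumes "Ck_on k U f" "Ck_on k U g" "open U"
  shows "Ck_on k U (\<lambda>z. f z + g z)"
  using assms
proof (induction k arbitrary: f g)
  case (Suc k)
  have "Ck_on k U (\<lambda>x. frechet_derivative (\<lambda>z. f z + g z) (at x) v)" for v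
    by (rule Ck_on_cong[of _ "\<lambda>x. frechet_derivative f (at x) v + frechet_derivative g (at x) v"])
      (use Suc in \<open>auto simp: frechet_derivative_plus\<close>)
  then show ?case using Suc.prems by auto
qed (auto intro!: continuous_intros)

lemma Ck_on_sum:
  assumes "\<And>i. i \<in> I \<Longrightarrow> Ck_on k U (f i)" "open U"
  shows "Ck_on k U (\<lambda>z. \<Sum>i\<in>I. f i z)"
proof (cases "finite I")
  case True
  then show ?thesis using assms
    by (induction I rule: finite_induct) (auto intro: Ck_on_const Ck_on_add)
qed (auto intro: Ck_on_const)

lemma Ck_on_linear:
  assumes "bounded_linear L" "Ck_on k U f" "open U"
  shows "Ck_on k U (\<lambda>z. L (f z))"
  using assms
proof (induction k arbitrary: f)
  case 0
  then show ?case by (simp add: bounded_linear.continuous_on)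
next
  case (Suc k)
  have "Ck_on k U (\<lambda>x. frechet_derivative (\<lambda>z. L (f z)) (at x) v)" for v
    by (rule Ck_on_cong[of _ "\<lambda>x. L (frechet_derivative f (at x) v)"])
      (use Suc in \<open>auto simp: frechet_derivative_linear\<close>)
  then show ?case using Suc.prems by (auto intro: differentiable_linear)
qed

lemma Ck_on_bilinear:
  assumes "bounded_bilinear B" "Ck_on k U f" "Ck_on k U g" "open U"
  shows "Ck_on k U (\<lambda>z. B (f z) (g z))"
  using assms
proof (induction k arbitrary: f g)
  case 0
  then show ?case by (simp add: bounded_bilinear.continuous_on)
next
  case (Suc k)
  have "Ck_on k U (\<lambda>x. frechet_derivative (\<lambda>z. B (f z) (g z)) (at x) v)" for v
    by (rule Ck_on_cong[of _ "\<lambda>q. B (f q) (frechet_derivative g (at q) v)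
                                  + B (frechet_derivative f (at q) v) (g q)"])
      (use Suc Suc.prems(2,3)[THEN Ck_on_lower] in
        \<open>auto simp: frechet_derivative_bilinear intro!: Ck_on_add\<close>)
  then show ?case using Suc.prems by (auto intro: differentiable_bilinear)
qed

lemma Ck_on_prod:
  fixes f :: "'i \<Rightarrow> 'a::euclidean_space \<Rightarrow> real"
  assumes "\<And>i. i \<in> I \<Longrightarrow> Ck_on k U (f i)" "open U"
  shows "Ck_on k U (\<lambda>z. \<Prod>i\<in>I. f i z)"
proof (cases "finite I")
  case True
  then show ?thesis using assms
    by (induction I rule: finite_induct)
      (auto intro: Ck_on_const Ck_on_bilinear[OF bounded_bilinear_mult])
qed (auto intro: Ck_on_const)

lemma Ck_on_inverse:
  fixes f :: "'a::euclidean_space \<Rightarrow> real"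
  assumes "Ck_on k U f" "open U" "\<And>z. z \<in> U \<Longrightarrow> f z \<noteq> 0"
  shows "Ck_on k U (\<lambda>z. inverse (f z))"
  using assms
proof (induction k)
  case (Suc k)
  have d: "((\<lambda>z. inverse (f z)) has_derivative
      (\<lambda>v. - (inverse (f q) * frechet_derivative f (at q) v * inverse (f q)))) (at q)"
    if "q \<in> U" for q
  proof -
    have f: "(f has_derivative frechet_derivative f (at q)) (at q)" "f q \<noteq> 0"
      using that Suc.prems by (auto simp: frechet_derivative_works)
    show ?thesis by (rule Deriv.has_derivative_inverse[OF f(2,1)])
  qed
  have i: "Ck_on k U (\<lambda>z. inverse (f z))"
    using Suc Ck_on_lower by blast
  have "Ck_on k U (\<lambda>q. (inverse (f q) * frechet_derivative f (at q) v) * inverse (f q))" for v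
    using Suc.prems i by (intro Ck_on_bilinear[OF bounded_bilinear_mult]) auto
  then have "Ck_on k U (\<lambda>q. - ((inverse (f q) * frechet_derivative f (at q) v) * inverse (f q)))" for v
    using Suc.prems by (intro Ck_on_linear[OF bounded_linear_minus[OF bounded_linear_ident]])
  then have "Ck_on k U (\<lambda>q. frechet_derivative (\<lambda>z. inverse (f z)) (at q) v)" for v
    by (rule Ck_on_cong[rotated 2, where g="\<lambda>q. frechet_derivative (\<lambda>z. inverse (f z)) (at q) v"])
      (use Suc.prems frechet_derivative_at[OF d, symmetric] in auto)
  then show ?case using d by (auto simp: differentiable_def)
qed (auto intro!: continuous_intros)

lemma Ck_on_compose:
  fixes f :: "'b::euclidean_space \<Rightarrow> 'c::euclidean_space" and g :: "'a::euclidean_space \<Rightarrow> 'b"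
  assumes "Ck_on k W f" "Ck_on k U g" "open W" "open U" "g ` U \<subseteq> W"
  shows "Ck_on k U (\<lambda>z. f (g z))"
  using assms
proof (induction k arbitrary: f)
  case 0
  then show ?case using continuous_on_compose2[of W f U g] by simp
next
  case (Suc k)
  have df: "f differentiable at (g q)" and dg: "g differentiable at q" if "q \<in> U" for q
    using that Suc.prems by auto
  have chain: "frechet_derivative (\<lambda>z. f (g z)) (at q) v =
     (\<Sum>b\<in>Basis. (frechet_derivative g (at q) v \<bullet> b) *\<^sub>R frechet_derivative f (at (g q)) b)"
    if "q \<in> U" for q v
    using frechet_derivative_compose[OF dg df, OF that that]
      frechet_derivative_expand[OF df[OF that], of "frechet_derivative g (at q) v"]
    by (simp only: comp_def)
  have "Ck_on k U (\<lambda>q. frechet_derivative (\<lambda>z. f (g z)) (at q) v)" for v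
  proof (rule Ck_on_cong[OF \<open>open U\<close> chain[symmetric]])
    have "Ck_on k U (\<lambda>q. frechet_derivative f (at (g q)) b)" for b
      using Suc.prems Ck_on_lower[OF Suc.prems(2)] by (intro Suc.IH) auto
    then show "Ck_on k U (\<lambda>q. \<Sum>b\<in>Basis. (frechet_derivative g (at q) v \<bullet> b) *\<^sub>R
        frechet_derivative f (at (g q)) b)"
      using Suc.prems
      by (intro Ck_on_sum Ck_on_bilinear[OF bounded_bilinear_scaleR]
          Ck_on_linear[OF bounded_linear_inner_left]) auto
  qed
  moreover have "(\<lambda>z. f (g z)) differentiable at q" if "q \<in> U" for q
    using differentiable_chain_at[OF dg df, OF that that] by (simp add: comp_def)
  ultimately show ?case by simp
qed

lemma smooth_on_differentiable: "smooth_on U f \<Longrightarrow> q \<in> U \<Longrightarrow> f differentiable at q"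
  unfolding smooth_on_def by (metis Ck_on.simps(2))

lemma smooth_on_open: "smooth_on U f \<Longrightarrow> open U"
  by (simp add: smooth_on_def)

lemma smooth_on_cong:
  assumes "smooth_on U f" "\<And>z. z \<in> U \<Longrightarrow> f z = g z"
  shows "smooth_on U g"
  using assms Ck_on_cong unfolding smooth_on_def by blast

lemma smooth_on_const: "open U \<Longrightarrow> smooth_on U (\<lambda>z. c)"
  by (simp add: smooth_on_def Ck_on_const)

lemma smooth_on_add: "smooth_on U f \<Longrightarrow> smooth_on U g \<Longrightarrow> smooth_on U (\<lambda>z. f z + g z)"
  by (simp add: smooth_on_def Ck_on_add)

lemma smooth_on_sum:
  "open U \<Longrightarrow> (\<And>i. i \<in> I \<Longrightarrow> smooth_on U (f i)) \<Longrightarrow> smooth_on U (\<lambda>z. \<Sum>i\<in>I. f i z)"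
  by (simp add: smooth_on_def Ck_on_sum)

lemma smooth_on_linear: "bounded_linear L \<Longrightarrow> smooth_on U f \<Longrightarrow> smooth_on U (\<lambda>z. L (f z))"
  by (simp add: smooth_on_def Ck_on_linear)

lemma smooth_on_bilinear:
  "bounded_bilinear B \<Longrightarrow> smooth_on U f \<Longrightarrow> smooth_on U g \<Longrightarrow> smooth_on U (\<lambda>z. B (f z) (g z))"
  by (simp add: smooth_on_def Ck_on_bilinear)

lemma smooth_on_prod:
  fixes f :: "'i \<Rightarrow> 'a::euclidean_space \<Rightarrow> real"
  shows "open U \<Longrightarrow> (\<And>i. i \<in> I \<Longrightarrow> smooth_on U (f i)) \<Longrightarrow> smooth_on U (\<lambda>z. \<Prod>i\<in>I. f i z)"
  by (simp add: smooth_on_def Ck_on_prod)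

lemma smooth_on_inverse:
  fixes f :: "'a::euclidean_space \<Rightarrow> real"
  shows "smooth_on U f \<Longrightarrow> (\<And>z. z \<in> U \<Longrightarrow> f z \<noteq> 0) \<Longrightarrow> smooth_on U (\<lambda>z. inverse (f z))"
  by (simp add: smooth_on_def Ck_on_inverse)

lemma smooth_on_compose:
  "smooth_on W f \<Longrightarrow> smooth_on U g \<Longrightarrow> g ` U \<subseteq> W \<Longrightarrow> smooth_on U (\<lambda>z. f (g z))"
  unfolding smooth_on_def by (blast intro: Ck_on_compose)

lemma smooth_on_frechet_derivative:
  "smooth_on U f \<Longrightarrow> smooth_on U (\<lambda>z. frechet_derivative f (at z) v)"
  unfolding smooth_on_def by (metis Ck_on.simps(2))

text \<open>Expanding the direction in the standard basis reduces a variable direction to constant ones, for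
  which smoothness of the derivative is part of the definition.\<close>

lemma smooth_on_along:
  fixes f :: "'a::euclidean_space \<Rightarrow> 'b::euclidean_space"
  assumes "smooth_on U f" "smooth_on U Y"
  shows "smooth_on U (\<lambda>z. frechet_derivative f (at z) (Y z))"
proof (rule smooth_on_cong)
  show "smooth_on U (\<lambda>z. \<Sum>b\<in>Basis. (Y z \<bullet> b) *\<^sub>R frechet_derivative f (at z) b)"
    using assms by (intro smooth_on_sum smooth_on_bilinear[OF bounded_bilinear_scaleR]
        smooth_on_linear[OF bounded_linear_inner_left] smooth_on_frechet_derivative smooth_on_open)
qed (metis assms(1) frechet_derivative_expand smooth_on_differentiable)

lemma frechet_derivative_along:
  fixes f :: "'a::euclidean_space \<Rightarrow> 'b::euclidean_space"
  assumes f: "smooth_on U f" and Y: "smooth_on U Y" and q: "q \<in> U"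
  shows "frechet_derivative (\<lambda>z. frechet_derivative f (at z) (Y z)) (at q) v =
    frechet_derivative (\<lambda>z. frechet_derivative f (at z) (Y q)) (at q) v
    + frechet_derivative f (at q) (frechet_derivative Y (at q) v)"
proof -
  let ?D = "\<lambda>b z. frechet_derivative f (at z) b"
  have D: "?D b differentiable at q" for b
    using smooth_on_differentiable[OF smooth_on_frechet_derivative[OF f] q] .
  have gen: "frechet_derivative (\<lambda>z. ?D (Z z) z) (at q) v =
      (\<Sum>b\<in>Basis. (Z q \<bullet> b) *\<^sub>R frechet_derivative (?D b) (at q) v)
      + ?D (frechet_derivative Z (at q) v) q" if Z: "smooth_on U Z" for Z
  proof -
    have dZ: "Z differentiable at q" using smooth_on_differentiable[OF Z q] .
    have "frechet_derivative (\<lambda>z. ?D (Z z) z) (at q) v =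
        frechet_derivative (\<lambda>z. \<Sum>b\<in>Basis. (Z z \<bullet> b) *\<^sub>R ?D b z) (at q) v"
      using frechet_derivative_expand smooth_on_differentiable[OF f]
      by (subst frechet_derivative_cong_open[OF smooth_on_open[OF f] q]) (auto intro: frechet_derivative_expand)
    also have "\<dots> = (\<Sum>b\<in>Basis. frechet_derivative (\<lambda>z. (Z z \<bullet> b) *\<^sub>R ?D b z) (at q) v)"
      by (intro frechet_derivative_sum differentiable_bilinear[OF bounded_bilinear_scaleR]
          differentiable_linear[OF bounded_linear_inner_left] dZ D)
    also have "\<dots> = (\<Sum>b\<in>Basis. (Z q \<bullet> b) *\<^sub>R frechet_derivative (?D b) (at q) v
        + (frechet_derivative Z (at q) v \<bullet> b) *\<^sub>R ?D b q)"
      by (simp add: frechet_derivative_bilinear[OF bounded_bilinear_scaleR] D dZ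
          differentiable_linear[OF bounded_linear_inner_left]
          frechet_derivative_linear[OF bounded_linear_inner_left])
    finally show ?thesis
      by (simp add: sum.distrib flip: frechet_derivative_expand[OF smooth_on_differentiable[OF f q]])
  qed
  show ?thesis
    using gen[OF Y] gen[OF smooth_on_const[OF smooth_on_open[OF f], of "Y q"]]
      linear_0[OF linear_frechet_derivative[OF smooth_on_differentiable[OF f q]]] by simp
qed

lemma smooth_on_vec:
  fixes f :: "'a::euclidean_space \<Rightarrow> 'b::euclidean_space^'k"
  assumes "open U" "\<And>i. smooth_on U (\<lambda>z. f z $ i)"
  shows "smooth_on U f"
proof -
  have lin: "bounded_linear (\<lambda>c. axis i c :: 'b^'k)" for i
    unfolding linear_conv_bounded_linear[symmetric]
    by (auto simp: linear_iff axis_def vec_eq_iff)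
  have "smooth_on U (\<lambda>z. \<Sum>i\<in>UNIV. axis i (f z $ i))"
    by (intro smooth_on_sum assms smooth_on_linear[OF lin])
  moreover have "(\<Sum>i\<in>UNIV. axis i (f z $ i)) = f z" for z
    by (simp add: vec_eq_iff axis_def if_distrib cong: if_cong)
  ultimately show ?thesis by simp
qed

lemma smooth_on_det:
  fixes A :: "'a::euclidean_space \<Rightarrow> real^'k^'k"
  assumes "open U" "\<And>i j. smooth_on U (\<lambda>z. A z $ i $ j)"
  shows "smooth_on U (\<lambda>z. det (A z))"
  unfolding det_def using assms
  by (intro smooth_on_sum smooth_on_bilinear[OF bounded_bilinear_mult] smooth_on_const smooth_on_prod) auto

text \<open>By Cramer's rule the solution of a linear system is a rational function of its data.\<close>

lemma smooth_on_linear_system: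
  fixes A :: "'a::euclidean_space \<Rightarrow> real^'k^'k"
  assumes "open U" "\<And>i j. smooth_on U (\<lambda>z. A z $ i $ j)" "\<And>i. smooth_on U (\<lambda>z. b z $ i)"
    and "\<And>z. z \<in> U \<Longrightarrow> det (A z) \<noteq> 0" "\<And>z. z \<in> U \<Longrightarrow> A z *v y z = b z"
  shows "smooth_on U y"
proof (rule smooth_on_vec[OF \<open>open U\<close>])
  fix k
  have "smooth_on U (\<lambda>z. det (\<chi> i j. if j = k then b z $ i else A z $ i $ j) * inverse (det (A z)))"
    (is "smooth_on U ?q")
  proof (intro smooth_on_bilinear[OF bounded_bilinear_mult] smooth_on_inverse smooth_on_det)
    show "smooth_on U (\<lambda>z. (\<chi> i j. if j = k then b z $ i else A z $ i $ j) $ i $ j)" for i j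
      using assms(2,3) by (cases "j = k") auto
  qed (use assms in auto)
  moreover have "?q z = y z $ k" if "z \<in> U" for z
    using cramer[OF assms(4)[OF that]] assms(5)[OF that] by (simp add: divide_inverse)
  ultimately show "smooth_on U (\<lambda>z. y z $ k)" by (rule smooth_on_cong)
qed

section \<open>Symmetry of second derivatives\<close>

text \<open>Two applications of the mean value theorem to the second difference over a parallelogram. The
  left hand side is symmetric in \<open>v\<close> and \<open>w\<close>, the right hand side is a mixed derivative.\<close>

lemma second_difference_mean_value:
  fixes f :: "'a::euclidean_space \<Rightarrow> real"
  assumes f: "smooth_on U f" and t: "0 < t"
    and U: "\<And>s r. \<lbrakk>0 \<le> s; s \<le> t; 0 \<le> r; r \<le> t\<rbrakk> \<Longrightarrow> q + s *\<^sub>R v + r *\<^sub>R w \<in> U"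
  shows "\<exists>s r. 0 < s \<and> s < t \<and> 0 < r \<and> r < t \<and>
    f (q + t *\<^sub>R v + t *\<^sub>R w) - f (q + t *\<^sub>R v) - f (q + t *\<^sub>R w) + f q =
    t * t * frechet_derivative (\<lambda>z. frechet_derivative f (at z) v) (at (q + s *\<^sub>R v + r *\<^sub>R w)) w"
proof -
  let ?d = "\<lambda>z. frechet_derivative f (at z) v"
  have line: "((\<lambda>s. h (a + s *\<^sub>R b)) has_real_derivative frechet_derivative h (at (a + s *\<^sub>R b)) b) (at s)"
    if "smooth_on U h" "a + s *\<^sub>R b \<in> U" for h :: "'a \<Rightarrow> real" and a b s
  proof -
    have h: "(h has_derivative frechet_derivative h (at (a + s *\<^sub>R b))) (at (a + s *\<^sub>R b))"
      using smooth_on_differentiable[OF that] by (simp add: frechet_derivative_works)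
    have "((\<lambda>s. a + s *\<^sub>R b) has_vector_derivative b) (at s)"
      by (auto intro!: derivative_eq_intros simp: has_vector_derivative_def)
    then have "((h \<circ> (\<lambda>s. a + s *\<^sub>R b)) has_vector_derivative
        frechet_derivative h (at (a + s *\<^sub>R b)) b) (at s)"
      using h by (intro vector_derivative_diff_chain_within[of _ _ _ UNIV, simplified])
        (auto intro: has_derivative_at_withinI)
    then show ?thesis
      by (simp add: comp_def has_real_derivative_iff_has_vector_derivative)
  qed
  let ?p = "\<lambda>s. f (q + t *\<^sub>R w + s *\<^sub>R v) - f (q + s *\<^sub>R v)"
  have "\<exists>s. 0 < s \<and> s < t \<and> ?p t - ?p 0 = (t - 0) * (?d (q + t *\<^sub>R w + s *\<^sub>R v) - ?d (q + s *\<^sub>R v))"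
  proof (rule MVT2[OF t])
    fix s assume s: "0 \<le> s" "s \<le> t"
    show "DERIV ?p s :> ?d (q + t *\<^sub>R w + s *\<^sub>R v) - ?d (q + s *\<^sub>R v)"
      using U[OF s, of t] U[OF s, of 0] t
      by (intro DERIV_diff line[OF f]) (auto simp: algebra_simps)
  qed
  then obtain s where s: "0 < s" "s < t"
    and 1: "?p t - ?p 0 = t * (?d (q + t *\<^sub>R w + s *\<^sub>R v) - ?d (q + s *\<^sub>R v))" by auto
  have "\<exists>r. 0 < r \<and> r < t \<and> ?d (q + s *\<^sub>R v + t *\<^sub>R w) - ?d (q + s *\<^sub>R v + 0 *\<^sub>R w) =
     (t - 0) * frechet_derivative ?d (at (q + s *\<^sub>R v + r *\<^sub>R w)) w"
    using s U by (intro MVT2[OF t] line smooth_on_frechet_derivative f) auto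
  then obtain r where r: "0 < r" "r < t" and 2: "?d (q + s *\<^sub>R v + t *\<^sub>R w) - ?d (q + s *\<^sub>R v) =
     t * frechet_derivative ?d (at (q + s *\<^sub>R v + r *\<^sub>R w)) w" by auto
  have "f (q + t *\<^sub>R v + t *\<^sub>R w) - f (q + t *\<^sub>R v) - f (q + t *\<^sub>R w) + f q = ?p t - ?p 0"
    by (simp add: algebra_simps)
  also have "\<dots> = t * (t * frechet_derivative ?d (at (q + s *\<^sub>R v + r *\<^sub>R w)) w)"
    using 1 2 by (simp add: algebra_simps)
  finally show ?thesis using s r by (auto simp: mult.assoc)
qed

lemma frechet_derivative_commute_real:
  fixes f :: "'a::euclidean_space \<Rightarrow> real"
  assumes f: "smooth_on U f" and q: "q \<in> U"
  shows "frechet_derivative (\<lambda>z. frechet_derivative f (at z) v) (at q) w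
       = frechet_derivative (\<lambda>z. frechet_derivative f (at z) w) (at q) v"
proof -
  let ?H = "\<lambda>v w z. frechet_derivative (\<lambda>z. frechet_derivative f (at z) v) (at z) w"
  have cont: "isCont (?H v w) q" for v w
    using f q by (intro differentiable_imp_continuous_within smooth_on_differentiable
        smooth_on_frechet_derivative)
  obtain e where e: "e > 0" "ball q e \<subseteq> U"
    using smooth_on_open[OF f] q openE by blast
  define c where "c = norm v + norm w + 1"
  have c: "c > 0" unfolding c_def by (simp add: add_nonneg_pos)
  define T where "T k = e / (c * real (k + 2))" for k
  have T: "T k > 0" for k using e c by (simp add: T_def)
  have near: "dist q (q + s *\<^sub>R v + r *\<^sub>R w) \<le> c * T k"
    if "0 \<le> s" "s \<le> T k" "0 \<le> r" "r \<le> T k" for s r k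
  proof -
    have "dist q (q + s *\<^sub>R v + r *\<^sub>R w) = norm (s *\<^sub>R v + r *\<^sub>R w)"
      by (metis add.assoc add_diff_cancel_left' dist_commute dist_norm)
    also have "\<dots> \<le> s * norm v + r * norm w"
      using norm_triangle_ineq[of "s *\<^sub>R v" "r *\<^sub>R w"] that by simp
    also have "\<dots> \<le> T k * norm v + T k * norm w"
      using that by (intro add_mono mult_right_mono) auto
    also have "\<dots> \<le> c * T k" using T[of k] by (simp add: c_def algebra_simps)
    finally show ?thesis .
  qed
  have small: "c * T k < e" for k
  proof -
    have "e * 1 < e * real (k + 2)" using e by (intro mult_strict_left_mono) auto
    then show ?thesis using c by (simp add: T_def divide_simps)
  qed
  have inU: "q + s *\<^sub>R v + r *\<^sub>R w \<in> U" if "0 \<le> s" "s \<le> T k" "0 \<le> r" "r \<le> T k" for s r k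
    using near[OF that] small[of k] e by (auto simp: subset_iff)
  have "\<exists>s r s' r'. 0 < s \<and> s < T k \<and> 0 < r \<and> r < T k \<and> 0 < s' \<and> s' < T k \<and> 0 < r' \<and> r' < T k \<and>
      ?H v w (q + s *\<^sub>R v + r *\<^sub>R w) = ?H w v (q + s' *\<^sub>R v + r' *\<^sub>R w)" for k
  proof -
    obtain s r where 1: "0 < s" "s < T k" "0 < r" "r < T k"
      "f (q + T k *\<^sub>R v + T k *\<^sub>R w) - f (q + T k *\<^sub>R v) - f (q + T k *\<^sub>R w) + f q =
       T k * T k * ?H v w (q + s *\<^sub>R v + r *\<^sub>R w)"
      using second_difference_mean_value[OF f T[of k], of q v w] inU by blast
    have "q + s *\<^sub>R w + r *\<^sub>R v \<in> U" if "0 \<le> s" "s \<le> T k" "0 \<le> r" "r \<le> T k" for s r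
      using inU[of r k s] that by (simp add: algebra_simps)
    then obtain r' s' where 2: "0 < r'" "r' < T k" "0 < s'" "s' < T k"
      "f (q + T k *\<^sub>R w + T k *\<^sub>R v) - f (q + T k *\<^sub>R w) - f (q + T k *\<^sub>R v) + f q =
       T k * T k * ?H w v (q + r' *\<^sub>R w + s' *\<^sub>R v)"
      using second_difference_mean_value[OF f T[of k], of q w v] by blast
    have "T k * T k * ?H v w (q + s *\<^sub>R v + r *\<^sub>R w) = T k * T k * ?H w v (q + s' *\<^sub>R v + r' *\<^sub>R w)"
      using 1(5) 2(5) by (simp add: algebra_simps)
    then have "?H v w (q + s *\<^sub>R v + r *\<^sub>R w) = ?H w v (q + s' *\<^sub>R v + r' *\<^sub>R w)"
      using T[of k] by simp
    then show ?thesis using 1 2 by blast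
  qed
  then obtain s r s' r' where b: "\<And>k. 0 < s k \<and> s k < T k \<and> 0 < r k \<and> r k < T k"
      "\<And>k. 0 < s' k \<and> s' k < T k \<and> 0 < r' k \<and> r' k < T k"
    and eq: "\<And>k. ?H v w (q + s k *\<^sub>R v + r k *\<^sub>R w) = ?H w v (q + s' k *\<^sub>R v + r' k *\<^sub>R w)"
    by metis
  have T0: "(\<lambda>k. c * T k) \<longlonglongrightarrow> 0"
  proof -
    have "(\<lambda>k. e * inverse (real (k + 2))) \<longlonglongrightarrow> e * 0"
      using LIMSEQ_ignore_initial_segment[OF lim_inverse_n, of 2] by (intro tendsto_mult_left) simp
    moreover have "c * T k = e * inverse (real (k + 2))" for k
      using c by (simp add: T_def divide_inverse)
    ultimately show ?thesis by simp
  qed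
  have lim: "(\<lambda>k. q + x k *\<^sub>R v + y k *\<^sub>R w) \<longlonglongrightarrow> q"
    if "\<And>k. 0 < x k \<and> x k < T k \<and> 0 < y k \<and> y k < T k" for x y
  proof (rule metric_tendsto_imp_tendsto[OF T0])
    have "dist (q + x k *\<^sub>R v + y k *\<^sub>R w) q \<le> dist (c * T k) 0" for k
      using near[of "x k" k "y k"] that[of k] by (simp add: dist_commute)
    then show "\<forall>\<^sub>F k in sequentially. dist (q + x k *\<^sub>R v + y k *\<^sub>R w) q \<le> dist (c * T k) 0"
      by simp
  qed
  have "(\<lambda>k. ?H v w (q + s k *\<^sub>R v + r k *\<^sub>R w)) \<longlonglongrightarrow> ?H v w q"
    by (rule isCont_tendsto_compose[OF cont lim[OF b(1)]])
  moreover have "(\<lambda>k. ?H w v (q + s' k *\<^sub>R v + r' k *\<^sub>R w)) \<longlonglongrightarrow> ?H w v q"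
    by (rule isCont_tendsto_compose[OF cont lim[OF b(2)]])
  ultimately show ?thesis unfolding eq by (rule LIMSEQ_unique)
qed

lemma frechet_derivative_commute:
  fixes f :: "'a::euclidean_space \<Rightarrow> 'b::euclidean_space"
  assumes f: "smooth_on U f" and q: "q \<in> U"
  shows "frechet_derivative (\<lambda>z. frechet_derivative f (at z) v) (at q) w
       = frechet_derivative (\<lambda>z. frechet_derivative f (at z) w) (at q) v"
proof (rule euclidean_eqI)
  fix b :: 'b
  have s: "smooth_on U (\<lambda>z. f z \<bullet> b)"
    by (rule smooth_on_linear[OF bounded_linear_inner_left f])
  have "frechet_derivative (\<lambda>z. frechet_derivative f (at z) v) (at q) w \<bullet> b =
      frechet_derivative (\<lambda>z. frechet_derivative (\<lambda>z. f z \<bullet> b) (at z) v) (at q) w" for v w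
  proof -
    have "frechet_derivative (\<lambda>z. frechet_derivative (\<lambda>z. f z \<bullet> b) (at z) v) (at q) =
        frechet_derivative (\<lambda>z. frechet_derivative f (at z) v \<bullet> b) (at q)"
      using smooth_on_open[OF f] q smooth_on_differentiable[OF f]
      by (intro frechet_derivative_cong_open[of U])
        (auto simp: frechet_derivative_linear[OF bounded_linear_inner_left])
    then show ?thesis
      using smooth_on_differentiable[OF smooth_on_frechet_derivative[OF f] q]
      by (simp add: frechet_derivative_linear[OF bounded_linear_inner_left])
  qed
  then show "frechet_derivative (\<lambda>z. frechet_derivative f (at z) v) (at q) w \<bullet> b =
      frechet_derivative (\<lambda>z. frechet_derivative f (at z) w) (at q) v \<bullet> b"
    using frechet_derivative_commute_real[OF s q] by simp
qed

section \<open>Matrix algebra\<close>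

lemma bounded_bilinear_matrix_mult:
  "bounded_bilinear ((**) :: real^'b^'a \<Rightarrow> real^'c^'b \<Rightarrow> real^'c^'a)"
  unfolding bilinear_conv_bounded_bilinear[symmetric] bilinear_def linear_iff
  by (simp add: vec_eq_iff matrix_matrix_mult_def algebra_simps sum.distrib sum_distrib_left)

lemmas matrix_mult_distribs =
  bounded_bilinear.add_left[OF bounded_bilinear_matrix_mult]
  bounded_bilinear.add_right[OF bounded_bilinear_matrix_mult]
  bounded_bilinear.diff_left[OF bounded_bilinear_matrix_mult]
  bounded_bilinear.diff_right[OF bounded_bilinear_matrix_mult]
  bounded_bilinear.sum_left[OF bounded_bilinear_matrix_mult]
  bounded_bilinear.sum_right[OF bounded_bilinear_matrix_mult]
  bounded_bilinear.scaleR_left[OF bounded_bilinear_matrix_mult]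
  bounded_bilinear.scaleR_right[OF bounded_bilinear_matrix_mult]
  bounded_bilinear.minus_left[OF bounded_bilinear_matrix_mult]
  bounded_bilinear.minus_right[OF bounded_bilinear_matrix_mult]

lemma inner_eq_trace: "A \<bullet> B = trace (transpose A ** (B :: real^'n^'n))"
  unfolding inner_vec_def trace_def matrix_matrix_mult_def transpose_def
  by (simp, rule sum.swap)

lemma transpose_diff: "transpose (A - B) = transpose A - transpose (B :: real^'n^'m)"
  by (simp add: transpose_def vec_eq_iff)

lemma bounded_linear_trace: "bounded_linear (trace :: real^'n^'n \<Rightarrow> real)"
  unfolding linear_conv_bounded_linear[symmetric] linear_iff
  by (simp add: trace_add) (simp add: trace_def sum_distrib_left)

lemma trace_sum: "trace (\<Sum>i\<in>I. A i) = (\<Sum>i\<in>I. trace (A i :: real^'n^'n))"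
  by (rule linear_sum[OF bounded_linear.linear[OF bounded_linear_trace]])

lemma trace_scaleR: "trace (c *\<^sub>R A) = c * trace (A :: real^'n^'n)"
  by (simp add: trace_def sum_distrib_left)

lemma bounded_bilinear_commutator: "bounded_bilinear (commutator :: real^'k^'k \<Rightarrow> _)"
  unfolding bilinear_conv_bounded_bilinear[symmetric] bilinear_def linear_iff commutator_def
  by (simp add: matrix_mult_distribs algebra_simps)

lemma trace_commutator: "trace (commutator A B) = 0"
  by (simp add: commutator_def trace_sub trace_mul_sym[of A B])

lemma trace_cyclic: "trace (A ** B ** C) = trace (B ** C ** (A :: real^'n^'n))"
  by (metis matrix_mul_assoc trace_mul_sym)

text \<open>The infinitesimal form of the invariance of the Frobenius product under conjugation.\<close>

lemma inner_commutator:
  "A \<bullet> commutator C B = commutator (transpose C) A \<bullet> (B :: real^'n^'n)"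
  using trace_cyclic[of "transpose A" B C]
  by (simp add: inner_eq_trace commutator_def transpose_diff matrix_transpose_mul
      matrix_mult_distribs trace_sub matrix_mul_assoc) (metis trace_cyclic)

text \<open>A family \<open>(B\<^sup>\<alpha>)\<close> of \<open>n \<times> n\<close> matrices is a two-tensor on an \<open>n\<close>-space with values in an
  \<open>m\<close>-space; \<open>act\<close> is the infinitesimal action of the two rotation groups on such tensors, and
  \<open>pairing\<close> contracts the tensor indices.\<close>

definition act :: "(real^'n^'n) \<times> (real^'m^'m) \<Rightarrow> real^'n^'n^'m \<Rightarrow> real^'n^'n^'m" where
  "act \<Gamma> B = (\<chi> \<alpha>. commutator (fst \<Gamma>) (B $ \<alpha>) + (\<Sum>\<beta>\<in>UNIV. snd \<Gamma> $ \<alpha> $ \<beta> *\<^sub>R B $ \<beta>))"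

definition pairing :: "real^'n^'n^'m \<Rightarrow> real^'n^'n^'m \<Rightarrow> real^'m^'m" where
  "pairing B C = (\<chi> \<alpha> \<beta>. B $ \<alpha> \<bullet> C $ \<beta>)"

lemma bounded_bilinear_act: "bounded_bilinear act"
  unfolding bilinear_conv_bounded_bilinear[symmetric] bilinear_def linear_iff
  by (simp add: vec_eq_iff act_def commutator_def matrix_mult_distribs
      algebra_simps sum.distrib sum_distrib_left)

lemma bounded_bilinear_pairing: "bounded_bilinear pairing"
  unfolding bilinear_conv_bounded_bilinear[symmetric] bilinear_def linear_iff
  by (simp add: vec_eq_iff pairing_def inner_add_left inner_add_right)

lemma act_commutator:
  "act \<Gamma> (act \<Gamma>' B) - act \<Gamma>' (act \<Gamma> B) =
   act (commutator (fst \<Gamma>) (fst \<Gamma>'), commutator (snd \<Gamma>) (snd \<Gamma>')) B"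
proof -
  have "(\<Sum>\<beta>\<in>UNIV. snd \<Gamma> $ \<alpha> $ \<beta> *\<^sub>R (\<Sum>\<gamma>\<in>UNIV. snd \<Gamma>' $ \<beta> $ \<gamma> *\<^sub>R B $ \<gamma>)) =
        (\<Sum>\<gamma>\<in>UNIV. (snd \<Gamma> ** snd \<Gamma>') $ \<alpha> $ \<gamma> *\<^sub>R B $ \<gamma>)" for \<Gamma> \<Gamma>' :: "(real^'a^'a) \<times> (real^'b^'b)" and \<alpha>
    by (simp add: matrix_matrix_mult_def scaleR_sum_left scaleR_sum_right) (rule sum.swap)
  then have "act \<Gamma> (act \<Gamma>' B) $ \<alpha> - act \<Gamma>' (act \<Gamma> B) $ \<alpha> =
   act (commutator (fst \<Gamma>) (fst \<Gamma>'), commutator (snd \<Gamma>) (snd \<Gamma>')) B $ \<alpha>" for \<alpha>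
    by (simp add: act_def commutator_def matrix_mult_distribs matrix_mul_assoc
        scaleR_add_right scaleR_diff_right scaleR_diff_left sum.distrib sum_subtractf algebra_simps)
  then show ?thesis by (simp add: vec_eq_iff)
qed

lemma pairing_act:
  assumes "transpose (fst \<Gamma>) = - fst \<Gamma>" "transpose (snd \<Gamma>) = - snd \<Gamma>"
  shows "pairing (act \<Gamma> B) C + pairing B (act \<Gamma> C) = commutator (snd \<Gamma>) (pairing B C)"
proof -
  have s: "snd \<Gamma> $ \<gamma> $ \<beta> = - snd \<Gamma> $ \<beta> $ \<gamma>" for \<beta> \<gamma>
    using arg_cong[OF assms(2), of "\<lambda>M. M $ \<beta> $ \<gamma>"] by (simp add: transpose_def)
  have n: "(\<Sum>\<gamma>\<in>UNIV. a \<gamma> * snd \<Gamma> $ \<gamma> $ \<beta>) = - (\<Sum>\<gamma>\<in>UNIV. snd \<Gamma> $ \<beta> $ \<gamma> * a \<gamma>)" for a \<beta>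
    unfolding sum_negf[symmetric] using s[of _ \<beta>] by (intro sum.cong refl) simp
  have "commutator (fst \<Gamma>) A \<bullet> A' + A \<bullet> commutator (fst \<Gamma>) A' = 0" for A A'
    using inner_commutator[of A "fst \<Gamma>" A'] assms(1)
    by (simp add: commutator_def matrix_mult_distribs inner_diff_left inner_diff_right)
  then have "commutator (fst \<Gamma>) A \<bullet> A' = - (A \<bullet> commutator (fst \<Gamma>) A')" for A A'
    by (simp add: eq_neg_iff_add_eq_0)
  then show ?thesis
    by (simp add: vec_eq_iff pairing_def act_def commutator_def[of "snd \<Gamma>"] n
        inner_add_left inner_add_right inner_sum_left inner_sum_right matrix_matrix_mult_def)
qed

lemma sum_rotate:
  "(\<Sum>a\<in>A. \<Sum>b\<in>B. \<Sum>c\<in>C. f a b c) = (\<Sum>c\<in>C. \<Sum>a\<in>A. \<Sum>b\<in>B. f a b c)"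
proof -
  have "(\<Sum>a\<in>A. \<Sum>b\<in>B. \<Sum>c\<in>C. f a b c) = (\<Sum>a\<in>A. \<Sum>c\<in>C. \<Sum>b\<in>B. f a b c)"
    by (intro sum.cong refl sum.swap)
  also have "\<dots> = (\<Sum>c\<in>C. \<Sum>a\<in>A. \<Sum>b\<in>B. f a b c)" by (rule sum.swap)
  finally show ?thesis .
qed

section \<open>The algebra of Simons' identity\<close>

text \<open>Curvature of the tangent and of the normal bundle of a submanifold of the unit sphere, as
  prescribed by the equations of Gauss and Ricci. The Kronecker terms are the constant curvature
  of the sphere.\<close>

definition gauss_curvature :: "real^'n^'n^'m \<Rightarrow> 'n \<Rightarrow> 'n \<Rightarrow> real^'n^'n" where
  "gauss_curvature h k l = (\<chi> i j. (\<Sum>\<gamma>\<in>UNIV. h$\<gamma>$i$k * h$\<gamma>$j$l - h$\<gamma>$i$l * h$\<gamma>$j$k)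
     + ((if i = k then 1 else 0) * (if j = l then 1 else 0)
        - (if i = l then 1 else 0) * (if j = k then 1 else 0)))"

definition normal_curvature :: "real^'n^'n^'m \<Rightarrow> 'n \<Rightarrow> 'n \<Rightarrow> real^'m^'m" where
  "normal_curvature h k l = (\<chi> \<alpha> \<beta>. \<Sum>i\<in>UNIV. h$\<alpha>$i$k * h$\<beta>$i$l - h$\<alpha>$i$l * h$\<beta>$i$k)"

lemma contracted_gauss_curvature:
  fixes h :: "real^'n^'n^'m"
  assumes tr: "\<And>\<alpha>. (\<Sum>i\<in>UNIV. h$\<alpha>$i$i) = 0"
  shows "(\<Sum>k\<in>UNIV. gauss_curvature h k j $ k $ p) =
     (real CARD('n) - 1) * mat 1 $ p $ j - (\<Sum>\<gamma>\<in>UNIV. (h$\<gamma> ** h$\<gamma>) $ p $ j)"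
proof -
  have "(\<Sum>k\<in>UNIV. gauss_curvature h k j $ k $ p) =
      (\<Sum>k\<in>UNIV. \<Sum>\<gamma>\<in>UNIV. h$\<gamma>$k$k * h$\<gamma>$p$j - h$\<gamma>$k$j * h$\<gamma>$p$k)
      + (\<Sum>k\<in>UNIV. (if p = j then 1 else 0) - (if k = j then 1 else 0) * (if p = k then 1 else 0))"
    by (simp add: gauss_curvature_def sum.distrib)
  also have "(\<Sum>k\<in>UNIV. \<Sum>\<gamma>\<in>UNIV. h$\<gamma>$k$k * h$\<gamma>$p$j - h$\<gamma>$k$j * h$\<gamma>$p$k) =
      (\<Sum>\<gamma>\<in>UNIV. \<Sum>k\<in>UNIV. h$\<gamma>$k$k * h$\<gamma>$p$j - h$\<gamma>$k$j * h$\<gamma>$p$k)"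
    by (rule sum.swap)
  also have "\<dots> = - (\<Sum>\<gamma>\<in>UNIV. (h$\<gamma> ** h$\<gamma>) $ p $ j)"
    by (simp add: sum_subtractf tr flip: sum_distrib_right)
      (simp add: matrix_matrix_mult_def mult.commute sum_negf)
  also have "(\<Sum>k\<in>UNIV. (if p = j then 1 else 0) - (if k = j then 1 else 0) * (if p = k then 1 else 0))
     = (real CARD('n) - 1) * mat 1 $ p $ j"
    by (simp add: sum_subtractf mat_def if_distrib[of "\<lambda>x. x * _"] cong: if_cong)
  finally show ?thesis by simp
qed

text \<open>This contraction is the error made in exchanging two covariant derivatives in the trace of the
  second derivative of \<open>h\<close>. The products of three matrices that it produces combine to a double
  commutator, which is why only commutators appear in the final formula.\<close>

lemma simons_curvature_term:
  fixes h :: "real^'n^'n^'m"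
  assumes sym: "\<And>\<alpha> i j. h$\<alpha>$i$j = h$\<alpha>$j$i" and tr: "\<And>\<alpha>. (\<Sum>i\<in>UNIV. h$\<alpha>$i$i) = 0"
  shows "(\<Sum>k\<in>UNIV. act (gauss_curvature h k j, normal_curvature h k j) h $ \<alpha> $ k $ i) =
    (real CARD('n) *\<^sub>R h$\<alpha> - (\<Sum>\<beta>\<in>UNIV. (h$\<alpha> \<bullet> h$\<beta>) *\<^sub>R h$\<beta>)
     - (\<Sum>\<beta>\<in>UNIV. commutator (h$\<beta>) (commutator (h$\<beta>) (h$\<alpha>)))) $ i $ j"
proof -
  let ?A = "h $ \<alpha>"
  have 1: "(\<Sum>k\<in>UNIV. (gauss_curvature h k j ** ?A) $ k $ i) =
      (real CARD('n) - 1) * ?A $ i $ j - (\<Sum>\<gamma>\<in>UNIV. (?A ** (h$\<gamma> ** h$\<gamma>)) $ i $ j)"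
  proof -
    have "(\<Sum>k\<in>UNIV. (gauss_curvature h k j ** ?A) $ k $ i) =
        (\<Sum>p\<in>UNIV. (\<Sum>k\<in>UNIV. gauss_curvature h k j $ k $ p) * ?A $ p $ i)"
      unfolding matrix_matrix_mult_def by (simp add: sum_distrib_right) (rule sum.swap)
    also have "\<dots> = (real CARD('n) - 1) * (\<Sum>p\<in>UNIV. ?A $ i $ p * mat 1 $ p $ j)
        - (\<Sum>p\<in>UNIV. \<Sum>\<gamma>\<in>UNIV. ?A $ i $ p * (h$\<gamma> ** h$\<gamma>) $ p $ j)"
      unfolding contracted_gauss_curvature[OF tr]
      by (simp add: sym[of \<alpha> _ i] left_diff_distrib right_diff_distrib sum_subtractf
          sum_distrib_left sum_distrib_right mult_ac)
    also have "(\<Sum>p\<in>UNIV. ?A $ i $ p * mat 1 $ p $ j) = (?A ** mat 1) $ i $ j"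
      by (simp add: matrix_matrix_mult_def)
    also have "(\<Sum>p\<in>UNIV. \<Sum>\<gamma>\<in>UNIV. ?A $ i $ p * (h$\<gamma> ** h$\<gamma>) $ p $ j) =
       (\<Sum>\<gamma>\<in>UNIV. (?A ** (h$\<gamma> ** h$\<gamma>)) $ i $ j)"
      by (subst sum.swap) (simp add: matrix_matrix_mult_def[of ?A])
    finally show ?thesis by simp
  qed
  have 2: "(\<Sum>k\<in>UNIV. (?A ** gauss_curvature h k j) $ k $ i) =
      (\<Sum>\<gamma>\<in>UNIV. (?A \<bullet> h$\<gamma>) * h$\<gamma> $ i $ j - (h$\<gamma> ** (?A ** h$\<gamma>)) $ i $ j) - ?A $ i $ j"
  proof -
    have "(\<Sum>k\<in>UNIV. (?A ** gauss_curvature h k j) $ k $ i) =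
      (\<Sum>k\<in>UNIV. \<Sum>p\<in>UNIV. \<Sum>\<gamma>\<in>UNIV. ?A$k$p * h$\<gamma>$p$k * h$\<gamma>$i$j - ?A$k$p * h$\<gamma>$p$j * h$\<gamma>$i$k)
      + (\<Sum>k\<in>UNIV. \<Sum>p\<in>UNIV. ?A$k$p * ((if p = k then 1 else 0) * (if i = j then 1 else 0)
           - (if p = j then 1 else 0) * (if i = k then 1 else 0)))"
      unfolding matrix_matrix_mult_def gauss_curvature_def
      by (simp only: vec_lambda_beta distrib_left sum.distrib)
         (simp add: sum_distrib_left sum_distrib_right right_diff_distrib mult.assoc)
    also have "(\<Sum>k\<in>UNIV. \<Sum>p\<in>UNIV. ?A$k$p * ((if p = k then 1 else 0) * (if i = j then 1 else 0)
           - (if p = j then 1 else 0) * (if i = k then 1 else 0)))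
       = (\<Sum>k\<in>UNIV. ?A$k$k) * (if i = j then 1 else 0) - ?A $ i $ j"
      by (simp add: right_diff_distrib sum_subtractf if_distrib[of "\<lambda>x. _ * x"] if_distrib[of "\<lambda>x. x * _"]
          sum.If_cases cong: if_cong)
    also have "(\<Sum>k\<in>UNIV. \<Sum>p\<in>UNIV. \<Sum>\<gamma>\<in>UNIV. ?A$k$p * h$\<gamma>$p$k * h$\<gamma>$i$j - ?A$k$p * h$\<gamma>$p$j * h$\<gamma>$i$k)
      = (\<Sum>\<gamma>\<in>UNIV. \<Sum>k\<in>UNIV. \<Sum>p\<in>UNIV. ?A$k$p * h$\<gamma>$k$p * h$\<gamma>$i$j - h$\<gamma>$i$k * (?A$k$p * h$\<gamma>$p$j))"
      unfolding sum_rotate[where C="UNIV :: 'm set"]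
      by (intro sum.cong refl) (simp add: sym[of _ i j] mult_ac, simp add: sym)
    also have "\<dots> = (\<Sum>\<gamma>\<in>UNIV. (?A \<bullet> h$\<gamma>) * h$\<gamma> $ i $ j - (h$\<gamma> ** (?A ** h$\<gamma>)) $ i $ j)"
      by (simp add: sum_subtractf inner_vec_def matrix_matrix_mult_def sum_distrib_left sum_distrib_right)
    finally show ?thesis by (simp add: tr)
  qed
  have 3: "(\<Sum>k\<in>UNIV. \<Sum>\<beta>\<in>UNIV. normal_curvature h k j $ \<alpha> $ \<beta> * h $ \<beta> $ k $ i) =
     (\<Sum>\<beta>\<in>UNIV. (h$\<beta> ** (?A ** h$\<beta>)) $ i $ j - (h$\<beta> ** (h$\<beta> ** ?A)) $ i $ j)"
  proof -
    have "(\<Sum>k\<in>UNIV. \<Sum>\<beta>\<in>UNIV. normal_curvature h k j $ \<alpha> $ \<beta> * h $ \<beta> $ k $ i) =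
       (\<Sum>\<beta>\<in>UNIV. \<Sum>k\<in>UNIV. \<Sum>p\<in>UNIV. h$\<beta>$i$k * (?A$k$p * h$\<beta>$p$j) - h$\<beta>$i$k * (h$\<beta>$k$p * ?A$p$j))"
      unfolding normal_curvature_def
      unfolding vec_lambda_beta sum_distrib_right
      by (subst sum.swap, intro sum.cong refl)
        (simp add: left_diff_distrib right_diff_distrib mult_ac sym)
    also have "\<dots> = (\<Sum>\<beta>\<in>UNIV. (h$\<beta> ** (?A ** h$\<beta>)) $ i $ j - (h$\<beta> ** (h$\<beta> ** ?A)) $ i $ j)"
      by (simp add: sum_subtractf matrix_matrix_mult_def sum_distrib_left)
    finally show ?thesis .
  qed
  have "(\<Sum>k\<in>UNIV. act (gauss_curvature h k j, normal_curvature h k j) h $ \<alpha> $ k $ i) =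
     (\<Sum>k\<in>UNIV. (gauss_curvature h k j ** ?A) $ k $ i) - (\<Sum>k\<in>UNIV. (?A ** gauss_curvature h k j) $ k $ i)
     + (\<Sum>k\<in>UNIV. \<Sum>\<beta>\<in>UNIV. normal_curvature h k j $ \<alpha> $ \<beta> * h $ \<beta> $ k $ i)"
    by (simp add: act_def commutator_def sum.distrib sum_subtractf)
  also have "\<dots> = (real CARD('n) *\<^sub>R h$\<alpha> - (\<Sum>\<beta>\<in>UNIV. (h$\<alpha> \<bullet> h$\<beta>) *\<^sub>R h$\<beta>)
     - (\<Sum>\<beta>\<in>UNIV. commutator (h$\<beta>) (commutator (h$\<beta>) (h$\<alpha>)))) $ i $ j"
    unfolding 1 2 3
    by (simp add: commutator_def matrix_mult_distribs matrix_mul_assoc sum.distrib sum_subtractf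
        sum_distrib_left algebra_simps)
  finally show ?thesis .
qed

lemma inner_double_commutator:
  assumes "transpose C = C"
  shows "A \<bullet> commutator C (commutator C A) = (norm (commutator C (A::real^'n^'n)))\<^sup>2"
  by (simp add: inner_commutator assms power2_norm_eq_inner)

section \<open>Powers of a matrix\<close>

lemma matrix_pow_diagonal:
  assumes "S = (\<chi> \<alpha> \<beta>. if \<alpha> = \<beta> then lam \<alpha> else 0)"
  shows "matrix_pow S r = (\<chi> \<alpha> \<beta>. if \<alpha> = \<beta> then lam \<alpha> ^ r else 0)"
  by (induction r)
    (simp_all add: assms vec_eq_iff mat_def matrix_matrix_mult_def if_distrib[of "\<lambda>x. x * _"] cong: if_cong)

lemma matrix_pow_commute_right:
  assumes "C ** S = S ** C"
  shows "C ** matrix_pow S r = matrix_pow S r ** C"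
  by (induction r) (simp_all, metis assms matrix_mul_assoc)

lemma sum_UNIV_pairs:
  "(\<Sum>(a, b)\<in>UNIV. f a b) = (\<Sum>a\<in>UNIV. \<Sum>b\<in>UNIV. f a b)"
  by (simp add: sum.cartesian_product)

lemma sum_add_eq_pairs:
  "(\<Sum>(s, t) \<in> {(s, t). s + t = (r::nat)}. g s t) = (\<Sum>s\<le>r. g s (r - s))"
proof -
  have "{(s, t). s + t = r} = (\<lambda>s. (s, r - s)) ` {..r}" by auto
  moreover have "inj_on (\<lambda>s. (s, r - s)) {..r}" by (auto simp: inj_on_def)
  ultimately show ?thesis by (simp add: sum.reindex)
qed

section \<open>Moving frames along an immersion into the sphere\<close>

text \<open>The position vector \<open>y\<close> on the unit sphere completes an orthonormal tangent frame to an
  orthonormal basis of the ambient space.\<close>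

lemma orthonormal_frame_inner:
  fixes b :: "'k::finite \<Rightarrow> 'e::euclidean_space"
  assumes dim: "DIM('e) = CARD('k) + 1"
    and b: "\<And>A B. b A \<bullet> b B = (if A = B then 1 else 0)" and y: "\<And>A. b A \<bullet> y = 0" "y \<bullet> y = 1"
  shows "u \<bullet> v = (\<Sum>A\<in>UNIV. (b A \<bullet> u) * (b A \<bullet> v)) + (y \<bullet> u) * (y \<bullet> v)"
proof -
  let ?B = "insert y (range b)"
  have inj: "inj b"
    by (rule injI) (metis b zero_neq_one)
  have notin: "y \<notin> range b"
    using y by force
  have orth: "pairwise orthogonal ?B"
    using b y by (auto simp: pairwise_def orthogonal_def inner_commute)
  have norm: "norm i = 1" if "i \<in> ?B" for i
    using that b y by (auto simp: norm_eq_1)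
  have "independent ?B"
    using norm[of 0] by (intro pairwise_orthogonal_independent orth) auto
  moreover have "card ?B = CARD('k) + 1"
    using notin inj by (simp add: card_image)
  ultimately have "UNIV \<subseteq> span ?B"
    by (intro card_ge_dim_independent) (auto simp: dim)
  then have "(\<Sum>i\<in>?B. (u \<bullet> i) *\<^sub>R i) = u"
    by (intro orthonormal_basis_expand orth norm) auto
  then have "u \<bullet> v = (\<Sum>i\<in>?B. (u \<bullet> i) *\<^sub>R i) \<bullet> v" by simp
  also have "\<dots> = (y \<bullet> u) * (y \<bullet> v) + (\<Sum>i\<in>range b. (i \<bullet> u) * (i \<bullet> v))"
    using notin by (simp add: inner_add_left inner_sum_left inner_commute[of u])
  also have "(\<Sum>i\<in>range b. (i \<bullet> u) * (i \<bullet> v)) = (\<Sum>A\<in>UNIV. (b A \<bullet> u) * (b A \<bullet> v))"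
    by (simp add: sum.reindex[OF inj])
  finally show ?thesis by simp
qed

lemma sum_UNIV_Plus:
  "(\<Sum>A\<in>UNIV. f A) = (\<Sum>i\<in>UNIV. f (Inl i)) + (\<Sum>\<alpha>\<in>UNIV. f (Inr \<alpha>))" for f :: "'a::finite + 'b::finite \<Rightarrow> _"
  by (subst UNIV_Plus_UNIV[symmetric], subst sum.Plus) auto

text \<open>The frame is regarded as a family of functions of the parameters, with values in the ambient
  Euclidean space; \<open>X k\<close> is the vector field on the parameter domain that the immersion \<open>g\<close> maps
  to the \<open>k\<close>-th tangent frame vector.\<close>

locale moving_frame =
  fixes V :: "(real^'n) set" and g :: "real^'n \<Rightarrow> 'e::euclidean_space"
    and \<epsilon> :: "'n + 'm::finite \<Rightarrow> real^'n \<Rightarrow> 'e" and X :: "'n \<Rightarrow> real^'n \<Rightarrow> real^'n"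
  assumes dim: "DIM('e) = CARD('n) + CARD('m) + 1"
    and smooth_g: "smooth_on V g" and smooth_\<epsilon>: "smooth_on V (\<epsilon> A)" and smooth_X: "smooth_on V (X k)"
    and g_unit: "q \<in> V \<Longrightarrow> g q \<bullet> g q = 1"
    and orthonormal: "q \<in> V \<Longrightarrow> \<epsilon> A q \<bullet> \<epsilon> B q = (if A = B then 1 else 0)"
    and \<epsilon>_g: "q \<in> V \<Longrightarrow> \<epsilon> A q \<bullet> g q = 0"
    and tangent: "q \<in> V \<Longrightarrow> frechet_derivative g (at q) (X k q) = \<epsilon> (Inl k) q"
    and normal: "q \<in> V \<Longrightarrow> \<epsilon> (Inr \<alpha>) q \<bullet> frechet_derivative g (at q) v = 0"
    and immersion: "q \<in> V \<Longrightarrow> inj (frechet_derivative g (at q))"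
begin

definition d :: "'n \<Rightarrow> (real^'n \<Rightarrow> 'z::euclidean_space) \<Rightarrow> real^'n \<Rightarrow> 'z" where
  "d k f q = frechet_derivative f (at q) (X k q)"

lemma open_V: "open V" by (rule smooth_on_open[OF smooth_g])

lemma smooth_d: "smooth_on V f \<Longrightarrow> smooth_on V (d k f)"
  unfolding d_def by (rule smooth_on_along[OF _ smooth_X])

lemma d_cong: "q \<in> V \<Longrightarrow> (\<And>z. z \<in> V \<Longrightarrow> f z = f' z) \<Longrightarrow> d k f q = d k f' q"
  unfolding d_def using frechet_derivative_cong_open[OF open_V] by metis

lemma d_const: "d k (\<lambda>z. c) q = 0"
  by (simp add: d_def)

lemma d_linear:
  "bounded_linear L \<Longrightarrow> smooth_on V f \<Longrightarrow> q \<in> V \<Longrightarrow> d k (\<lambda>z. L (f z)) q = L (d k f q)"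
  by (simp add: d_def frechet_derivative_linear smooth_on_differentiable)

lemma d_bilinear:
  "bounded_bilinear B \<Longrightarrow> smooth_on V f \<Longrightarrow> smooth_on V f' \<Longrightarrow> q \<in> V \<Longrightarrow>
    d k (\<lambda>z. B (f z) (f' z)) q = B (f q) (d k f' q) + B (d k f q) (f' q)"
  by (simp add: d_def frechet_derivative_bilinear smooth_on_differentiable)

lemma d_plus:
  "smooth_on V f \<Longrightarrow> smooth_on V f' \<Longrightarrow> q \<in> V \<Longrightarrow> d k (\<lambda>z. f z + f' z) q = d k f q + d k f' q"
  by (simp add: d_def frechet_derivative_plus smooth_on_differentiable)

lemma d_vec: "smooth_on V f \<Longrightarrow> q \<in> V \<Longrightarrow> d k (\<lambda>z. f z $ i) q = d k f q $ i"
  by (rule d_linear[OF bounded_linear_vec_nth])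

lemma smooth_vec: "smooth_on V f \<Longrightarrow> smooth_on V (\<lambda>z. f z $ i)"
  by (rule smooth_on_linear[OF bounded_linear_vec_nth])

lemma d_vec2:
  fixes B :: "real^'n \<Rightarrow> real^'a^'b"
  shows "smooth_on V B \<Longrightarrow> q \<in> V \<Longrightarrow> d k (\<lambda>z. B z $ i $ j) q = d k B q $ i $ j"
  by (simp add: d_vec smooth_vec)

lemma d_vec3:
  fixes B :: "real^'n \<Rightarrow> real^'a^'b^'c"
  shows "smooth_on V B \<Longrightarrow> q \<in> V \<Longrightarrow> d k (\<lambda>z. B z $ \<alpha> $ i $ j) q = d k B q $ \<alpha> $ i $ j"
  by (simp add: d_vec smooth_vec)

text \<open>A second derivative along the frame is the Hessian in constant directions plus the derivative
  along the derivative of the field. Only the last term fails to be symmetric.\<close>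

lemma d_d: "smooth_on V f \<Longrightarrow> q \<in> V \<Longrightarrow> d k (d l f) q =
    frechet_derivative (\<lambda>z. frechet_derivative f (at z) (X l q)) (at q) (X k q)
    + frechet_derivative f (at q) (frechet_derivative (X l) (at q) (X k q))"
  unfolding d_def by (rule frechet_derivative_along[OF _ smooth_X])

lemma d_g: "q \<in> V \<Longrightarrow> d k g q = \<epsilon> (Inl k) q"
  by (simp add: d_def tangent)

lemma frame_inner:
  assumes q: "q \<in> V"
  shows "u \<bullet> v = (\<Sum>i\<in>UNIV. (\<epsilon> (Inl i) q \<bullet> u) * (\<epsilon> (Inl i) q \<bullet> v))
    + (\<Sum>\<alpha>\<in>UNIV. (\<epsilon> (Inr \<alpha>) q \<bullet> u) * (\<epsilon> (Inr \<alpha>) q \<bullet> v)) + (g q \<bullet> u) * (g q \<bullet> v)"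
proof -
  have "CARD('n + 'm) = CARD('n) + CARD('m)"
    using card_Plus[of "UNIV :: 'n set" "UNIV :: 'm set"] by simp
  then show ?thesis
    using orthonormal_frame_inner[of "\<lambda>A. \<epsilon> A q" "g q" u v] orthonormal \<epsilon>_g g_unit dim q
    by (simp add: sum_UNIV_Plus)
qed

lemma d_\<epsilon>_skew: "q \<in> V \<Longrightarrow> \<epsilon> A q \<bullet> d k (\<epsilon> B) q = - (\<epsilon> B q \<bullet> d k (\<epsilon> A) q)"
proof -
  assume q: "q \<in> V"
  have "d k (\<lambda>z. \<epsilon> A z \<bullet> \<epsilon> B z) q = d k (\<lambda>z. if A = B then 1 else 0) q"
    by (rule d_cong[OF q orthonormal])
  then show ?thesis
    by (simp add: d_bilinear[OF bounded_bilinear_inner smooth_\<epsilon> smooth_\<epsilon> q] d_const inner_commute)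
qed

lemma g_d_\<epsilon>: "q \<in> V \<Longrightarrow> g q \<bullet> d k (\<epsilon> A) q = (if A = Inl k then - 1 else 0)"
proof -
  assume q: "q \<in> V"
  have "d k (\<lambda>z. \<epsilon> A z \<bullet> g z) q = d k (\<lambda>z. 0::real) q"
    by (rule d_cong[OF q \<epsilon>_g])
  then show ?thesis
    using q by (auto simp: d_bilinear[OF bounded_bilinear_inner smooth_\<epsilon> smooth_g] d_const d_g
        orthonormal inner_commute[of "g q"] split: if_splits)
qed

lemma g_frechet_derivative: "q \<in> V \<Longrightarrow> g q \<bullet> frechet_derivative g (at q) v = 0"
proof -
  assume q: "q \<in> V"
  have "frechet_derivative (\<lambda>z. g z \<bullet> g z) (at q) v = frechet_derivative (\<lambda>z. 1::real) (at q) v"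
    using frechet_derivative_cong_open[OF open_V q, of "\<lambda>z. g z \<bullet> g z" "\<lambda>z. 1"] g_unit by simp
  then show ?thesis
    using smooth_on_differentiable[OF smooth_g q]
    by (simp add: frechet_derivative_bilinear[OF bounded_bilinear_inner] inner_commute)
qed

lemma linear_dg: "q \<in> V \<Longrightarrow> linear (frechet_derivative g (at q))"
  by (rule linear_frechet_derivative[OF smooth_on_differentiable[OF smooth_g]])

text \<open>The image of the derivative of \<open>g\<close> is orthogonal to the position vector and to the normal
  frame, so it is spanned by the images of the \<open>X j\<close>; injectivity carries this back to the parameters.\<close>

lemma X_expand:
  assumes q: "q \<in> V"
  shows "v = (\<Sum>j\<in>UNIV. (\<epsilon> (Inl j) q \<bullet> frechet_derivative g (at q) v) *\<^sub>R X j q)"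
proof -
  interpret linear "frechet_derivative g (at q)" by (rule linear_dg[OF q])
  let ?c = "\<lambda>j. \<epsilon> (Inl j) q \<bullet> frechet_derivative g (at q) v"
  have "frechet_derivative g (at q) v = frechet_derivative g (at q) (\<Sum>j\<in>UNIV. ?c j *\<^sub>R X j q)"
  proof (rule euclidean_eqI)
    fix b :: 'e
    show "frechet_derivative g (at q) v \<bullet> b = frechet_derivative g (at q) (\<Sum>j\<in>UNIV. ?c j *\<^sub>R X j q) \<bullet> b"
      using q by (subst frame_inner[OF q])
        (simp add: normal g_frechet_derivative sum scale tangent inner_sum_left)
  qed
  then show ?thesis by (rule injD[OF immersion[OF q]])
qed

text \<open>The connection forms evaluated on the frame, \<open>t\<^sub>k = (\<omega>\<^sub>i\<^sub>j(e\<^sub>k))\<close>, \<open>\<nu>\<^sub>k = (\<omega>\<^sub>\<alpha>\<^sub>\<beta>(e\<^sub>k))\<close> and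
  \<open>h\<^sup>\<alpha>\<^sub>i\<^sub>j = \<omega>\<^sub>\<alpha>\<^sub>i(e\<^sub>j)\<close>.\<close>

definition t :: "'n \<Rightarrow> real^'n \<Rightarrow> real^'n^'n" where
  "t k q = (\<chi> i j. \<epsilon> (Inl i) q \<bullet> d k (\<epsilon> (Inl j)) q)"

definition \<nu> :: "'n \<Rightarrow> real^'n \<Rightarrow> real^'m^'m" where
  "\<nu> k q = (\<chi> \<alpha> \<beta>. \<epsilon> (Inr \<alpha>) q \<bullet> d k (\<epsilon> (Inr \<beta>)) q)"

definition h :: "real^'n \<Rightarrow> real^'n^'n^'m" where
  "h q = (\<chi> \<alpha> i j. \<epsilon> (Inr \<alpha>) q \<bullet> d j (\<epsilon> (Inl i)) q)"

lemma smooth_inner_d: "smooth_on V (\<lambda>q. \<epsilon> A q \<bullet> d k (\<epsilon> B) q)"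
  by (intro smooth_on_bilinear[OF bounded_bilinear_inner] smooth_d smooth_\<epsilon>)

lemma smooth_t: "smooth_on V (t k)"
  by (intro smooth_on_vec[OF open_V]) (simp add: t_def smooth_inner_d)

lemma smooth_\<nu>: "smooth_on V (\<nu> k)"
  by (intro smooth_on_vec[OF open_V]) (simp add: \<nu>_def smooth_inner_d)

lemma smooth_h: "smooth_on V h"
  by (intro smooth_on_vec[OF open_V]) (simp add: h_def smooth_inner_d)

lemma t_skew: "q \<in> V \<Longrightarrow> t k q $ i $ j = - t k q $ j $ i"
  by (simp add: t_def d_\<epsilon>_skew[of q "Inl i"])

lemma transpose_t: "q \<in> V \<Longrightarrow> transpose (t k q) = - t k q"
  by (simp add: vec_eq_iff transpose_def) (metis t_skew)

lemma \<nu>_skew: "q \<in> V \<Longrightarrow> \<nu> k q $ \<alpha> $ \<beta> = - \<nu> k q $ \<beta> $ \<alpha>"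
  by (simp add: \<nu>_def d_\<epsilon>_skew[of q "Inr \<alpha>"])

lemma transpose_\<nu>: "q \<in> V \<Longrightarrow> transpose (\<nu> k q) = - \<nu> k q"
  by (simp add: vec_eq_iff transpose_def) (metis \<nu>_skew)

text \<open>Applied to the immersion \<open>g\<close> itself, the commutator of two frame fields is
  \<open>d\<^sub>k \<epsilon>\<^sub>l - d\<^sub>l \<epsilon>\<^sub>k\<close>, and this vector is tangential. Its tangential components are the structure
  functions of the frame, and the vanishing of its normal ones is the symmetry of \<open>h\<close>.\<close>

lemma bracket:
  assumes q: "q \<in> V"
  shows "frechet_derivative (X l) (at q) (X k q) - frechet_derivative (X k) (at q) (X l q)
       = (\<Sum>j\<in>UNIV. (t k q $ j $ l - t l q $ j $ k) *\<^sub>R X j q)" (is "?b = _")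
    and "\<epsilon> (Inr \<alpha>) q \<bullet> d k (\<epsilon> (Inl l)) q = \<epsilon> (Inr \<alpha>) q \<bullet> d l (\<epsilon> (Inl k)) q"
proof -
  interpret linear "frechet_derivative g (at q)" by (rule linear_dg[OF q])
  have dd: "d k (\<epsilon> (Inl l)) q = d k (d l g) q" for k l
    by (rule d_cong[OF q]) (simp add: d_g)
  have b: "frechet_derivative g (at q) ?b = d k (\<epsilon> (Inl l)) q - d l (\<epsilon> (Inl k)) q"
    unfolding dd d_d[OF smooth_g q] diff
    using frechet_derivative_commute[OF smooth_g q] by simp
  show "?b = (\<Sum>j\<in>UNIV. (t k q $ j $ l - t l q $ j $ k) *\<^sub>R X j q)"
    using X_expand[OF q, of ?b] by (simp add: b t_def inner_diff_right)
  show "\<epsilon> (Inr \<alpha>) q \<bullet> d k (\<epsilon> (Inl l)) q = \<epsilon> (Inr \<alpha>) q \<bullet> d l (\<epsilon> (Inl k)) q"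
    using normal[OF q, of \<alpha> ?b] by (simp add: b inner_diff_right)
qed

lemma d_commute:
  fixes f :: "real^'n \<Rightarrow> 'z::euclidean_space"
  assumes f: "smooth_on V f" and q: "q \<in> V"
  shows "d k (d l f) q - d l (d k f) q = (\<Sum>j\<in>UNIV. (t k q $ j $ l - t l q $ j $ k) *\<^sub>R d j f q)"
proof -
  interpret linear "frechet_derivative f (at q)"
    by (rule linear_frechet_derivative[OF smooth_on_differentiable[OF f q]])
  have "d k (d l f) q - d l (d k f) q = frechet_derivative f (at q)
      (frechet_derivative (X l) (at q) (X k q) - frechet_derivative (X k) (at q) (X l q))"
    unfolding d_d[OF f q] diff using frechet_derivative_commute[OF f q] by simp
  then show ?thesis by (simp add: bracket[OF q] sum scale d_def)
qed

lemma h_sym: "q \<in> V \<Longrightarrow> h q $ \<alpha> $ i $ j = h q $ \<alpha> $ j $ i"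
  by (simp add: h_def bracket(2))

lemma d_\<epsilon>_inner:
  assumes q: "q \<in> V"
  shows "d k (\<epsilon> A) q \<bullet> d l (\<epsilon> B) q =
      (\<Sum>p\<in>UNIV. (\<epsilon> (Inl p) q \<bullet> d k (\<epsilon> A) q) * (\<epsilon> (Inl p) q \<bullet> d l (\<epsilon> B) q))
    + (\<Sum>\<gamma>\<in>UNIV. (\<epsilon> (Inr \<gamma>) q \<bullet> d k (\<epsilon> A) q) * (\<epsilon> (Inr \<gamma>) q \<bullet> d l (\<epsilon> B) q))
    + (if A = Inl k then 1 else 0) * (if B = Inl l then 1 else 0)"
  using g_d_\<epsilon>[OF q] by (subst frame_inner[OF q]) simp

text \<open>Flatness of the ambient space: the second derivatives of \<open>\<epsilon>\<^sub>B\<close> commute up to the bracket of the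
  frame fields. The cases \<open>A, B\<close> tangential, normal and mixed are the equations of Gauss, Ricci and
  Codazzi.\<close>

lemma structure_equation:
  assumes q: "q \<in> V"
  shows "d k (\<lambda>z. \<epsilon> A z \<bullet> d l (\<epsilon> B) z) q - d l (\<lambda>z. \<epsilon> A z \<bullet> d k (\<epsilon> B) z) q =
     (\<Sum>j\<in>UNIV. (t k q $ j $ l - t l q $ j $ k) * (\<epsilon> A q \<bullet> d j (\<epsilon> B) q))
     + (d k (\<epsilon> A) q \<bullet> d l (\<epsilon> B) q - d l (\<epsilon> A) q \<bullet> d k (\<epsilon> B) q)"
proof -
  have "d k (\<lambda>z. \<epsilon> A z \<bullet> d l (\<epsilon> B) z) q =
      \<epsilon> A q \<bullet> d k (d l (\<epsilon> B)) q + d k (\<epsilon> A) q \<bullet> d l (\<epsilon> B) q" for k l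
    by (rule d_bilinear[OF bounded_bilinear_inner smooth_\<epsilon> smooth_d[OF smooth_\<epsilon>] q])
  then have "d k (\<lambda>z. \<epsilon> A z \<bullet> d l (\<epsilon> B) z) q - d l (\<lambda>z. \<epsilon> A z \<bullet> d k (\<epsilon> B) z) q =
      \<epsilon> A q \<bullet> (d k (d l (\<epsilon> B)) q - d l (d k (\<epsilon> B)) q)
      + (d k (\<epsilon> A) q \<bullet> d l (\<epsilon> B) q - d l (\<epsilon> A) q \<bullet> d k (\<epsilon> B) q)"
    by (simp add: inner_diff_right)
  then show ?thesis
    by (simp add: d_commute[OF smooth_\<epsilon> q] inner_sum_right)
qed

subsection \<open>The covariant derivative of the second fundamental form\<close>

text \<open>The direction index \<open>k\<close> is not treated as a tensor index: in a repeated derivative the frame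
  components of the full covariant derivative are
  \<open>nabla l (nabla k B) - (\<Sum>p. t l q $ p $ k *\<^sub>R nabla p B q)\<close>.\<close>

definition nabla :: "'n \<Rightarrow> (real^'n \<Rightarrow> real^'n^'n^'m) \<Rightarrow> real^'n \<Rightarrow> real^'n^'n^'m" where
  "nabla k B q = d k B q + act (t k q, \<nu> k q) (B q)"

lemma smooth_pair: "smooth_on V (\<lambda>q. (t k q, \<nu> k q))"
proof -
  have "bounded_linear (\<lambda>x. (x, 0))" "bounded_linear (\<lambda>y. (0, y))"
    by (auto intro: bounded_linear_Pair bounded_linear_ident bounded_linear_zero)
  from smooth_on_add[OF smooth_on_linear[OF this(1) smooth_t] smooth_on_linear[OF this(2) smooth_\<nu>]]
  show ?thesis by simp
qed

lemma d_pair: "q \<in> V \<Longrightarrow> d k (\<lambda>q. (t l q, \<nu> l q)) q = (d k (t l) q, d k (\<nu> l) q)"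
  using d_linear[OF bounded_linear_fst smooth_pair, of q k l]
    d_linear[OF bounded_linear_snd smooth_pair, of q k l] by (simp add: prod_eq_iff eta_contract_eq)

lemma smooth_nabla: "smooth_on V B \<Longrightarrow> smooth_on V (nabla k B)"
  unfolding nabla_def
  by (intro smooth_on_add smooth_d smooth_on_bilinear[OF bounded_bilinear_act] smooth_pair)

lemma nabla_nth:
  "nabla k B q $ \<alpha> $ i $ j = d k B q $ \<alpha> $ i $ j
     + ((\<Sum>p\<in>UNIV. t k q $ i $ p * B q $ \<alpha> $ p $ j) - (\<Sum>p\<in>UNIV. B q $ \<alpha> $ i $ p * t k q $ p $ j)
     + (\<Sum>\<beta>\<in>UNIV. \<nu> k q $ \<alpha> $ \<beta> * B q $ \<beta> $ i $ j))"
  by (simp add: nabla_def act_def commutator_def matrix_matrix_mult_def)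

lemma nabla_sym:
  assumes q: "q \<in> V" and B: "smooth_on V B" "\<And>z \<alpha> i j. z \<in> V \<Longrightarrow> B z $ \<alpha> $ i $ j = B z $ \<alpha> $ j $ i"
  shows "nabla k B q $ \<alpha> $ i $ j = nabla k B q $ \<alpha> $ j $ i"
proof -
  have "d k B q $ \<alpha> $ i $ j = d k (\<lambda>z. B z $ \<alpha> $ i $ j) q" for i j
    using B(1) q by (simp add: d_vec3)
  moreover have "d k (\<lambda>z. B z $ \<alpha> $ i $ j) q = d k (\<lambda>z. B z $ \<alpha> $ j $ i) q"
    by (rule d_cong[OF q]) (rule B(2))
  moreover have "(\<Sum>p\<in>UNIV. B q $ \<alpha> $ i $ p * t k q $ p $ j) = - (\<Sum>p\<in>UNIV. t k q $ j $ p * B q $ \<alpha> $ p $ i)" for i j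
    unfolding sum_negf[symmetric]
  proof (intro sum.cong refl)
    fix p
    show "B q $ \<alpha> $ i $ p * t k q $ p $ j = - (t k q $ j $ p * B q $ \<alpha> $ p $ i)"
      using t_skew[OF q, of k p j] B(2)[OF q, of \<alpha> i p] by simp
  qed
  moreover have "(\<Sum>\<beta>\<in>UNIV. \<nu> k q $ \<alpha> $ \<beta> * B q $ \<beta> $ i $ j) = (\<Sum>\<beta>\<in>UNIV. \<nu> k q $ \<alpha> $ \<beta> * B q $ \<beta> $ j $ i)"
    using B(2)[OF q, of _ i j] by simp
  ultimately show ?thesis by (simp add: nabla_nth)
qed

lemma nabla_h_sym: "q \<in> V \<Longrightarrow> nabla k h q $ \<alpha> $ i $ j = nabla k h q $ \<alpha> $ j $ i"
  by (rule nabla_sym[OF _ smooth_h h_sym])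

lemma codazzi:
  assumes q: "q \<in> V"
  shows "nabla k h q $ \<alpha> $ i $ j = nabla j h q $ \<alpha> $ i $ k"
proof -
  have dh: "d k h q $ \<alpha> $ i $ j = d k (\<lambda>z. \<epsilon> (Inr \<alpha>) z \<bullet> d j (\<epsilon> (Inl i)) z) q" for k j
    unfolding d_vec3[OF smooth_h q, symmetric] by (simp add: h_def)
  have dd: "d k h q $ \<alpha> $ i $ j - d j h q $ \<alpha> $ i $ k =
      (\<Sum>p\<in>UNIV. (t k q $ p $ j - t j q $ p $ k) * h q $ \<alpha> $ i $ p)
      + ((\<Sum>p\<in>UNIV. - h q $ \<alpha> $ p $ k * t j q $ p $ i) + (\<Sum>\<gamma>\<in>UNIV. - \<nu> k q $ \<alpha> $ \<gamma> * h q $ \<gamma> $ i $ j))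
      - ((\<Sum>p\<in>UNIV. - h q $ \<alpha> $ p $ j * t k q $ p $ i) + (\<Sum>\<gamma>\<in>UNIV. - \<nu> j q $ \<alpha> $ \<gamma> * h q $ \<gamma> $ i $ k))"
    unfolding dh structure_equation[OF q] d_\<epsilon>_inner[OF q]
    by (simp add: d_\<epsilon>_skew[OF q, of "Inl p" _ "Inr \<alpha>" for p] d_\<epsilon>_skew[OF q, of "Inr \<gamma>" _ "Inr \<alpha>" for \<gamma>] h_def t_def \<nu>_def)
  have flip: "(\<Sum>p\<in>UNIV. - h q $ \<alpha> $ p $ k * t j q $ p $ i) = (\<Sum>p\<in>UNIV. t j q $ i $ p * h q $ \<alpha> $ p $ k)" for k j
  proof (intro sum.cong refl)
    fix p show "- h q $ \<alpha> $ p $ k * t j q $ p $ i = t j q $ i $ p * h q $ \<alpha> $ p $ k"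
      using t_skew[OF q, of j p i] by simp
  qed
  show ?thesis
    using dd[unfolded flip] by (simp add: nabla_nth left_diff_distrib right_diff_distrib sum_subtractf sum_negf mult.commute)
qed

subsection \<open>The Gauss and Ricci equations and the commutation of covariant derivatives\<close>

lemma gauss_equation:
  assumes q: "q \<in> V"
  shows "d k (t l) q - d l (t k) q + commutator (t k q) (t l q) =
    (\<Sum>j\<in>UNIV. (t k q $ j $ l - t l q $ j $ k) *\<^sub>R t j q) + gauss_curvature (h q) k l"
proof -
  have flip: "(\<Sum>p\<in>UNIV. t k q $ p $ i * t l q $ p $ j) = - (t k q ** t l q) $ i $ j" for k l i j
    unfolding matrix_matrix_mult_def vec_lambda_beta sum_negf[symmetric]
  proof (intro sum.cong refl)
    fix p show "t k q $ p $ i * t l q $ p $ j = - (t k q $ i $ p * t l q $ p $ j)"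
      using t_skew[OF q, of k p i] by simp
  qed
  have "d k (t l) q $ i $ j = d k (\<lambda>z. \<epsilon> (Inl i) z \<bullet> d l (\<epsilon> (Inl j)) z) q" for k l i j
    unfolding d_vec2[OF smooth_t q, symmetric] by (simp add: t_def)
  then have "(d k (t l) q - d l (t k) q) $ i $ j =
      (\<Sum>p\<in>UNIV. (t k q $ p $ l - t l q $ p $ k) * t p q $ i $ j)
      + (((\<Sum>p\<in>UNIV. t k q $ p $ i * t l q $ p $ j) + (\<Sum>\<gamma>\<in>UNIV. h q $ \<gamma> $ i $ k * h q $ \<gamma> $ j $ l)
          + (if i = k then 1 else 0) * (if j = l then 1 else 0))
       - ((\<Sum>p\<in>UNIV. t l q $ p $ i * t k q $ p $ j) + (\<Sum>\<gamma>\<in>UNIV. h q $ \<gamma> $ i $ l * h q $ \<gamma> $ j $ k)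
          + (if i = l then 1 else 0) * (if j = k then 1 else 0)))" for i j
    by (simp only: vector_minus_component structure_equation[OF q] d_\<epsilon>_inner[OF q])
      (simp add: t_def h_def)
  from this[unfolded flip] show ?thesis
    by (simp add: vec_eq_iff commutator_def gauss_curvature_def sum_subtractf)
qed

lemma ricci_equation:
  assumes q: "q \<in> V"
  shows "d k (\<nu> l) q - d l (\<nu> k) q + commutator (\<nu> k q) (\<nu> l q) =
    (\<Sum>j\<in>UNIV. (t k q $ j $ l - t l q $ j $ k) *\<^sub>R \<nu> j q) + normal_curvature (h q) k l"
proof -
  have flip: "(\<Sum>p\<in>UNIV. \<nu> k q $ p $ i * \<nu> l q $ p $ j) = - (\<nu> k q ** \<nu> l q) $ i $ j" for k l i j
    unfolding matrix_matrix_mult_def vec_lambda_beta sum_negf[symmetric]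
  proof (intro sum.cong refl)
    fix p show "\<nu> k q $ p $ i * \<nu> l q $ p $ j = - (\<nu> k q $ i $ p * \<nu> l q $ p $ j)"
      using \<nu>_skew[OF q, of k p i] by simp
  qed
  have "d k (\<nu> l) q $ \<alpha> $ \<beta> = d k (\<lambda>z. \<epsilon> (Inr \<alpha>) z \<bullet> d l (\<epsilon> (Inr \<beta>)) z) q" for k l \<alpha> \<beta>
    unfolding d_vec2[OF smooth_\<nu> q, symmetric] by (simp add: \<nu>_def)
  then have "(d k (\<nu> l) q - d l (\<nu> k) q) $ \<alpha> $ \<beta> =
      (\<Sum>p\<in>UNIV. (t k q $ p $ l - t l q $ p $ k) * \<nu> p q $ \<alpha> $ \<beta>)
      + (((\<Sum>p\<in>UNIV. h q $ \<alpha> $ p $ k * h q $ \<beta> $ p $ l) + (\<Sum>\<gamma>\<in>UNIV. \<nu> k q $ \<gamma> $ \<alpha> * \<nu> l q $ \<gamma> $ \<beta>))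
       - ((\<Sum>p\<in>UNIV. h q $ \<alpha> $ p $ l * h q $ \<beta> $ p $ k) + (\<Sum>\<gamma>\<in>UNIV. \<nu> l q $ \<gamma> $ \<alpha> * \<nu> k q $ \<gamma> $ \<beta>)))" for \<alpha> \<beta>
    by (simp only: vector_minus_component structure_equation[OF q] d_\<epsilon>_inner[OF q])
      (simp add: \<nu>_def h_def d_\<epsilon>_skew[OF q, of "Inl p" for p])
  from this[unfolded flip] show ?thesis
    by (simp add: vec_eq_iff commutator_def normal_curvature_def sum_subtractf)
qed

lemma nabla_nabla:
  assumes q: "q \<in> V" and B: "smooth_on V B"
  shows "nabla k (nabla l B) q = d k (d l B) q + act (t l q, \<nu> l q) (d k B q)
     + act (d k (t l) q, d k (\<nu> l) q) (B q) + act (t k q, \<nu> k q) (d l B q)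
     + act (t k q, \<nu> k q) (act (t l q, \<nu> l q) (B q))"
proof -
  have "d k (nabla l B) q = d k (d l B) q + (act (t l q, \<nu> l q) (d k B q)
     + act (d k (t l) q, d k (\<nu> l) q) (B q))"
    unfolding nabla_def
    by (subst d_plus[OF smooth_d[OF B] _ q])
      (simp_all add: smooth_on_bilinear[OF bounded_bilinear_act smooth_pair B]
        d_bilinear[OF bounded_bilinear_act smooth_pair B q] d_pair[OF q])
  then show ?thesis
    by (simp add: nabla_def bounded_bilinear.add_right[OF bounded_bilinear_act])
qed

text \<open>Both curvatures act through the same representation as the connection, because \<open>act\<close> turns
  commutators of connection matrices into commutators of operators.\<close>

lemma ricci_identity:
  assumes q: "q \<in> V" and B: "smooth_on V B"
  shows "nabla k (nabla l B) q - nabla l (nabla k B) q =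
     (\<Sum>j\<in>UNIV. (t k q $ j $ l - t l q $ j $ k) *\<^sub>R nabla j B q)
     + act (gauss_curvature (h q) k l, normal_curvature (h q) k l) (B q)"
proof -
  interpret act: bounded_bilinear act by (rule bounded_bilinear_act)
  let ?c = "\<lambda>j. t k q $ j $ l - t l q $ j $ k"
  let ?b = "B q"
  have "nabla k (nabla l B) q - nabla l (nabla k B) q = (d k (d l B) q - d l (d k B) q)
     + (act (d k (t l) q, d k (\<nu> l) q) ?b - act (d l (t k) q, d l (\<nu> k) q) ?b
     + act (commutator (t k q) (t l q), commutator (\<nu> k q) (\<nu> l q)) ?b)"
    using act_commutator[of "(t k q, \<nu> k q)" "(t l q, \<nu> l q)" ?b]
    unfolding nabla_nabla[OF q B] by (simp add: algebra_simps)
  also have "act (d k (t l) q, d k (\<nu> l) q) ?b - act (d l (t k) q, d l (\<nu> k) q) ?b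
     + act (commutator (t k q) (t l q), commutator (\<nu> k q) (\<nu> l q)) ?b
    = act (d k (t l) q - d l (t k) q + commutator (t k q) (t l q),
           d k (\<nu> l) q - d l (\<nu> k) q + commutator (\<nu> k q) (\<nu> l q)) ?b"
    by (simp flip: act.diff_left act.add_left)
  also have "(d k (t l) q - d l (t k) q + commutator (t k q) (t l q),
           d k (\<nu> l) q - d l (\<nu> k) q + commutator (\<nu> k q) (\<nu> l q)) =
       (\<Sum>j\<in>UNIV. ?c j *\<^sub>R (t j q, \<nu> j q))
       + (gauss_curvature (h q) k l, normal_curvature (h q) k l)"
    unfolding gauss_equation[OF q] ricci_equation[OF q]
    by (simp add: prod_eq_iff fst_sum snd_sum)
  also have "act \<dots> ?b = (\<Sum>j\<in>UNIV. ?c j *\<^sub>R act (t j q, \<nu> j q) ?b)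
     + act (gauss_curvature (h q) k l, normal_curvature (h q) k l) ?b"
    by (simp only: act.add_left act.sum_left act.scaleR_left)
  finally have "nabla k (nabla l B) q - nabla l (nabla k B) q =
     (\<Sum>j\<in>UNIV. ?c j *\<^sub>R d j B q) + ((\<Sum>j\<in>UNIV. ?c j *\<^sub>R act (t j q, \<nu> j q) ?b)
     + act (gauss_curvature (h q) k l, normal_curvature (h q) k l) ?b)"
    unfolding d_commute[OF B q] .
  moreover have "(\<Sum>j\<in>UNIV. ?c j *\<^sub>R nabla j B q) =
     (\<Sum>j\<in>UNIV. ?c j *\<^sub>R d j B q) + (\<Sum>j\<in>UNIV. ?c j *\<^sub>R act (t j q, \<nu> j q) ?b)"
    by (simp add: nabla_def scaleR_add_right sum.distrib)
  ultimately show ?thesis by (simp only: add.assoc)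
qed

text \<open>Commutators have trace zero, so the connection acts on the traces only through the normal
  indices.\<close>

lemma trace_nabla:
  assumes q: "q \<in> V" and B: "smooth_on V B" "\<And>z \<alpha>. z \<in> V \<Longrightarrow> trace (B z $ \<alpha>) = 0"
  shows "trace (nabla k B q $ \<alpha>) = 0"
proof -
  have "trace (d k B q $ \<alpha>) = d k (\<lambda>z. trace (B z $ \<alpha>)) q"
    using q by (simp add: d_linear[OF bounded_linear_trace smooth_vec[OF B(1)]] d_vec[OF B(1)])
  also have "\<dots> = d k (\<lambda>z. 0) q" by (rule d_cong[OF q B(2)])
  finally show ?thesis
    by (simp add: nabla_def act_def trace_add trace_commutator trace_sum trace_scaleR B(2)[OF q] d_const)
qed

definition rough_laplacian :: "(real^'n \<Rightarrow> real^'n^'n^'m) \<Rightarrow> real^'n \<Rightarrow> real^'n^'n^'m" where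
  "rough_laplacian B q =
     (\<Sum>k\<in>UNIV. nabla k (nabla k B) q - (\<Sum>j\<in>UNIV. t k q $ j $ k *\<^sub>R nabla j B q))"

lemma simons_identity:
  assumes q: "q \<in> V" and min: "\<And>z \<alpha>. z \<in> V \<Longrightarrow> trace (h z $ \<alpha>) = 0"
  shows "rough_laplacian h q $ \<alpha> =
     real CARD('n) *\<^sub>R h q $ \<alpha> - (\<Sum>\<beta>\<in>UNIV. (h q $ \<alpha> \<bullet> h q $ \<beta>) *\<^sub>R h q $ \<beta>)
     - (\<Sum>\<beta>\<in>UNIV. commutator (h q $ \<beta>) (commutator (h q $ \<beta>) (h q $ \<alpha>)))"
proof -
  \<comment> \<open>\<open>K k l $ \<alpha> $ i $ j\<close> is the component \<open>h\<^sup>\<alpha>\<^sub>i\<^sub>j\<^sub>k\<^sub>l\<close> of the second covariant derivative. It is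
    symmetric in \<open>i\<close>, \<open>j\<close>, \<open>k\<close> because the first derivative is.\<close>
  define K where "K k l = nabla l (nabla k h) q - (\<Sum>p\<in>UNIV. t l q $ p $ k *\<^sub>R nabla p h q)" for k l
  note smooth = smooth_nabla[OF smooth_h]
  have K12: "K k l $ \<alpha> $ i $ j = K k l $ \<alpha> $ j $ i" for k l i j
    using nabla_sym[OF q smooth nabla_h_sym, of l k \<alpha> i j]
    by (simp add: K_def nabla_h_sym[OF q, of _ _ i j])
  have K23: "K k l $ \<alpha> $ i $ j = K j l $ \<alpha> $ i $ k" for k l i j
  proof -
    have "d l (nabla k h) q $ \<alpha> $ i $ j = d l (nabla j h) q $ \<alpha> $ i $ k"
      unfolding d_vec3[OF smooth q, symmetric] by (rule d_cong[OF q codazzi])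
    moreover have "(\<Sum>p\<in>UNIV. nabla k h q $ \<alpha> $ i $ p * t l q $ p $ j) =
        (\<Sum>p\<in>UNIV. t l q $ p $ j * nabla p h q $ \<alpha> $ i $ k)" for k j
      by (intro sum.cong refl) (metis codazzi[OF q] mult.commute)
    moreover have "(\<Sum>p\<in>UNIV. t l q $ i $ p * nabla k h q $ \<alpha> $ p $ j) =
        (\<Sum>p\<in>UNIV. t l q $ i $ p * nabla j h q $ \<alpha> $ p $ k)"
      "(\<Sum>\<beta>\<in>UNIV. \<nu> l q $ \<alpha> $ \<beta> * nabla k h q $ \<beta> $ i $ j) =
        (\<Sum>\<beta>\<in>UNIV. \<nu> l q $ \<alpha> $ \<beta> * nabla j h q $ \<beta> $ i $ k)"
      by (simp_all only: codazzi[OF q, of k _ _ j])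
    ultimately show ?thesis
      by (simp add: K_def nabla_nth[of _ "nabla _ h"])
  qed
  have comm: "K j k = K k j + act (gauss_curvature (h q) k j, normal_curvature (h q) k j) (h q)" for j k
    using ricci_identity[OF q smooth_h, of k j]
    by (simp add: K_def scaleR_diff_left sum_subtractf algebra_simps)
  have tr: "trace (K k l $ \<alpha>) = 0" for k l
    using trace_nabla[OF q smooth trace_nabla[OF _ smooth_h min]] trace_nabla[OF q smooth_h min]
    by (simp add: K_def trace_sub trace_sum trace_scaleR)
  have "rough_laplacian h q $ \<alpha> $ i $ j =
    (real CARD('n) *\<^sub>R h q $ \<alpha> - (\<Sum>\<beta>\<in>UNIV. (h q $ \<alpha> \<bullet> h q $ \<beta>) *\<^sub>R h q $ \<beta>)
     - (\<Sum>\<beta>\<in>UNIV. commutator (h q $ \<beta>) (commutator (h q $ \<beta>) (h q $ \<alpha>)))) $ i $ j" for i j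
  proof -
    have "rough_laplacian h q $ \<alpha> $ i $ j = (\<Sum>k\<in>UNIV. K k k $ \<alpha> $ i $ j)"
      by (simp add: rough_laplacian_def K_def)
    also have "\<dots> = (\<Sum>k\<in>UNIV. K j k $ \<alpha> $ k $ i)"
    proof (intro sum.cong refl)
      fix k show "K k k $ \<alpha> $ i $ j = K j k $ \<alpha> $ k $ i"
        using K23[of k k i j] K12[of j k i k] by simp
    qed
    also have "\<dots> = (\<Sum>k\<in>UNIV. K i j $ \<alpha> $ k $ k)
       + (\<Sum>k\<in>UNIV. act (gauss_curvature (h q) k j, normal_curvature (h q) k j) (h q) $ \<alpha> $ k $ i)"
      unfolding sum.distrib[symmetric]
    proof (intro sum.cong refl)
      fix k
      show "K j k $ \<alpha> $ k $ i = K i j $ \<alpha> $ k $ k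
          + act (gauss_curvature (h q) k j, normal_curvature (h q) k j) (h q) $ \<alpha> $ k $ i"
        using K23[of k j k i] comm[of j k] by simp
    qed
    also have "(\<Sum>k\<in>UNIV. K i j $ \<alpha> $ k $ k) = 0"
      using tr by (simp add: trace_def)
    also have "0 + (\<Sum>k\<in>UNIV. act (gauss_curvature (h q) k j, normal_curvature (h q) k j) (h q) $ \<alpha> $ k $ i) =
      (real CARD('n) *\<^sub>R h q $ \<alpha> - (\<Sum>\<beta>\<in>UNIV. (h q $ \<alpha> \<bullet> h q $ \<beta>) *\<^sub>R h q $ \<beta>)
       - (\<Sum>\<beta>\<in>UNIV. commutator (h q $ \<beta>) (commutator (h q $ \<beta>) (h q $ \<alpha>)))) $ i $ j"
      unfolding add_0
      by (rule simons_curvature_term) (use h_sym[OF q] min[OF q] in \<open>auto simp: trace_def\<close>)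
  finally show ?thesis .
  qed
  then show ?thesis by (simp add: vec_eq_iff)
qed

section \<open>The Laplacian of a trace of powers\<close>

text \<open>Written with matrices, the two connection terms in the covariant derivative of the fundamental
  matrix form a commutator, by skew symmetry of the connection.\<close>

definition nabla_perp :: "'n \<Rightarrow> (real^'n \<Rightarrow> real^'m^'m) \<Rightarrow> real^'n \<Rightarrow> real^'m^'m" where
  "nabla_perp k B q = d k B q + commutator (\<nu> k q) (B q)"

lemma nabla_perp_cong:
  assumes "q \<in> V" "\<And>z. z \<in> V \<Longrightarrow> B z = C z"
  shows "nabla_perp k B q = nabla_perp k C q"
  using d_cong[of q B C k] assms by (simp add: nabla_perp_def)

lemma smooth_nabla_perp: "smooth_on V B \<Longrightarrow> smooth_on V (nabla_perp k B)"
  unfolding nabla_perp_def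
  by (intro smooth_on_add smooth_d smooth_on_bilinear[OF bounded_bilinear_commutator] smooth_\<nu>)

lemma nabla_perp_mult:
  assumes "smooth_on V B" "smooth_on V C" "q \<in> V"
  shows "nabla_perp k (\<lambda>z. B z ** C z) q = nabla_perp k B q ** C q + B q ** nabla_perp k C q"
  by (simp add: nabla_perp_def d_bilinear[OF bounded_bilinear_matrix_mult assms] commutator_def
      matrix_mult_distribs matrix_mul_assoc)

lemma d_trace:
  assumes "smooth_on V B" "q \<in> V"
  shows "d k (\<lambda>z. trace (B z)) q = trace (nabla_perp k B q)"
  by (simp add: nabla_perp_def d_linear[OF bounded_linear_trace assms] trace_add trace_commutator)

lemma smooth_matrix_pow: "smooth_on V S \<Longrightarrow> smooth_on V (\<lambda>z. matrix_pow (S z) r)"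
  by (induction r) (auto intro: smooth_on_const open_V smooth_on_bilinear[OF bounded_bilinear_matrix_mult])

lemma nabla_perp_matrix_pow_Suc:
  assumes "smooth_on V S" "q \<in> V"
  shows "nabla_perp k (\<lambda>z. matrix_pow (S z) (Suc r)) q =
    nabla_perp k S q ** matrix_pow (S q) r + S q ** nabla_perp k (\<lambda>z. matrix_pow (S z) r) q"
  using nabla_perp_mult[OF assms(1) smooth_matrix_pow[OF assms(1)] assms(2)] by simp

text \<open>Under the trace the factors of a power may be permuted cyclically, so all terms of the product
  rule contribute equally. The factor \<open>C\<close> makes the induction on \<open>r\<close> work.\<close>

lemma trace_nabla_perp_matrix_pow:
  assumes S: "smooth_on V S" "q \<in> V" and C: "C ** S q = S q ** C"
  shows "trace (C ** nabla_perp k (\<lambda>z. matrix_pow (S z) r) q) =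
     real r * trace (C ** matrix_pow (S q) (r - 1) ** nabla_perp k S q)"
  using C
proof (induction r arbitrary: C)
  case 0
  then show ?case by (simp add: nabla_perp_def d_const commutator_def trace_def)
next
  case (Suc r)
  have "trace (C ** (nabla_perp k S q ** matrix_pow (S q) r)) = trace (matrix_pow (S q) r ** C ** nabla_perp k S q)"
    by (metis trace_cyclic matrix_mul_assoc)
  also have "\<dots> = trace (C ** matrix_pow (S q) r ** nabla_perp k S q)"
    by (simp add: matrix_pow_commute_right[OF Suc.prems])
  finally have 1: "trace (C ** (nabla_perp k S q ** matrix_pow (S q) r)) = \<dots>" .
  have "trace (C ** (S q ** nabla_perp k (\<lambda>z. matrix_pow (S z) r) q)) =
      real r * trace (C ** S q ** matrix_pow (S q) (r - 1) ** nabla_perp k S q)"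
    using Suc.IH[of "C ** S q"] Suc.prems by (metis matrix_mul_assoc)
  also have "\<dots> = real r * trace (C ** matrix_pow (S q) r ** nabla_perp k S q)"
    by (cases r) (simp_all add: matrix_mul_assoc)
  finally show ?case
    by (simp only: nabla_perp_matrix_pow_Suc[OF S] matrix_mult_distribs trace_add 1)
      (simp add: algebra_simps)
qed

text \<open>The trace of the Hessian \<open>e\<^sub>k (e\<^sub>k u) - (\<nabla>\<^sub>k e\<^sub>k) u\<close>.\<close>

definition frame_laplacian :: "(real^'n \<Rightarrow> real) \<Rightarrow> real^'n \<Rightarrow> real" where
  "frame_laplacian u q = (\<Sum>k\<in>UNIV. d k (d k u) q - (\<Sum>j\<in>UNIV. t k q $ j $ k * d j u q))"

lemma frame_laplacian_trace_matrix_pow: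
  assumes S: "smooth_on V S" and q: "q \<in> V"
  shows "frame_laplacian (\<lambda>z. trace (matrix_pow (S z) p)) q = real p *
    ((\<Sum>k\<in>UNIV. trace (nabla_perp k (\<lambda>z. matrix_pow (S z) (p - 1)) q ** nabla_perp k S q))
     + trace (matrix_pow (S q) (p - 1) **
        (\<Sum>k\<in>UNIV. nabla_perp k (nabla_perp k S) q - (\<Sum>j\<in>UNIV. t k q $ j $ k *\<^sub>R nabla_perp j S q))))"
proof -
  let ?P = "\<lambda>z. matrix_pow (S z) (p - 1)"
  have d1: "d k (\<lambda>z. trace (matrix_pow (S z) p)) z = real p * trace (?P z ** nabla_perp k S z)" if "z \<in> V" for k z
    using trace_nabla_perp_matrix_pow[OF S that, of "mat 1"] that
    by (simp add: d_trace[OF smooth_matrix_pow[OF S]])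
  have d2: "d k (d k (\<lambda>z. trace (matrix_pow (S z) p))) q =
      real p * trace (nabla_perp k ?P q ** nabla_perp k S q + ?P q ** nabla_perp k (nabla_perp k S) q)" for k
  proof -
    have s: "smooth_on V (\<lambda>z. ?P z ** nabla_perp k S z)"
      by (intro smooth_on_bilinear[OF bounded_bilinear_matrix_mult] smooth_matrix_pow smooth_nabla_perp S)
    have "d k (d k (\<lambda>z. trace (matrix_pow (S z) p))) q = d k (\<lambda>z. real p * trace (?P z ** nabla_perp k S z)) q"
      by (rule d_cong[OF q d1])
    also have "\<dots> = real p * d k (\<lambda>z. trace (?P z ** nabla_perp k S z)) q"
      by (rule d_linear[OF bounded_linear_mult_right smooth_on_linear[OF bounded_linear_trace s] q])
    finally show ?thesis
      by (simp only: d_trace[OF s q] nabla_perp_mult[OF smooth_matrix_pow[OF S] smooth_nabla_perp[OF S] q])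
  qed
  show ?thesis
    by (simp add: frame_laplacian_def d1[OF q] d2 matrix_mult_distribs trace_add trace_sub trace_sum trace_scaleR
        sum.distrib sum_subtractf sum_distrib_left algebra_simps)
qed

lemma smooth_pairing:
  "smooth_on V B \<Longrightarrow> smooth_on V C \<Longrightarrow> smooth_on V (\<lambda>z. pairing (B z) (C z))"
  by (rule smooth_on_bilinear[OF bounded_bilinear_pairing])

lemma nabla_perp_pairing:
  assumes "smooth_on V B" "smooth_on V C" "q \<in> V"
  shows "nabla_perp k (\<lambda>z. pairing (B z) (C z)) q = pairing (nabla k B q) (C q) + pairing (B q) (nabla k C q)"
proof -
  interpret pairing: bounded_bilinear pairing by (rule bounded_bilinear_pairing)
  have "commutator (\<nu> k q) (pairing (B q) (C q)) =
      pairing (act (t k q, \<nu> k q) (B q)) (C q) + pairing (B q) (act (t k q, \<nu> k q) (C q))"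
    using pairing_act[of "(t k q, \<nu> k q)" "B q" "C q"] transpose_t transpose_\<nu> assms(3) by simp
  then show ?thesis
    by (simp add: nabla_perp_def nabla_def d_bilinear[OF bounded_bilinear_pairing assms]
        pairing.add_left pairing.add_right algebra_simps)
qed

lemma laplacian_pairing_h:
  assumes q: "q \<in> V"
  defines "S \<equiv> \<lambda>z. pairing (h z) (h z)"
  shows "(\<Sum>k\<in>UNIV. nabla_perp k (nabla_perp k S) q - (\<Sum>j\<in>UNIV. t k q $ j $ k *\<^sub>R nabla_perp j S q)) =
     pairing (rough_laplacian h q) (h q) + pairing (h q) (rough_laplacian h q)
     + 2 *\<^sub>R (\<Sum>k\<in>UNIV. pairing (nabla k h q) (nabla k h q))"
proof -
  interpret pairing: bounded_bilinear pairing by (rule bounded_bilinear_pairing)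
  note s = smooth_h smooth_nabla[OF smooth_h]
  have D1: "nabla_perp k S z = pairing (nabla k h z) (h z) + pairing (h z) (nabla k h z)" if "z \<in> V" for k z
    unfolding S_def by (rule nabla_perp_pairing[OF s(1,1) that])
  have D2: "nabla_perp k (nabla_perp k S) q = pairing (nabla k (nabla k h) q) (h q) + pairing (h q) (nabla k (nabla k h) q)
     + 2 *\<^sub>R pairing (nabla k h q) (nabla k h q)" for k
  proof -
    have "nabla_perp k (nabla_perp k S) q = nabla_perp k (\<lambda>z. pairing (nabla k h z) (h z) + pairing (h z) (nabla k h z)) q"
      by (rule nabla_perp_cong[OF q D1])
    also have "\<dots> = nabla_perp k (\<lambda>z. pairing (nabla k h z) (h z)) q + nabla_perp k (\<lambda>z. pairing (h z) (nabla k h z)) q"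
      by (simp add: nabla_perp_def d_plus smooth_pairing s q bounded_bilinear.add_right[OF bounded_bilinear_commutator])
    finally show ?thesis
      by (simp add: nabla_perp_pairing s q scaleR_2)
  qed
  define L where "L k = nabla k (nabla k h) q - (\<Sum>j\<in>UNIV. t k q $ j $ k *\<^sub>R nabla j h q)" for k
  have "nabla_perp k (nabla_perp k S) q - (\<Sum>j\<in>UNIV. t k q $ j $ k *\<^sub>R nabla_perp j S q) =
      pairing (L k) (h q) + pairing (h q) (L k) + 2 *\<^sub>R pairing (nabla k h q) (nabla k h q)" for k
    by (simp add: L_def D1[OF q] D2 pairing.diff_left pairing.diff_right pairing.sum_left
        pairing.sum_right pairing.scaleR_left pairing.scaleR_right scaleR_add_right sum.distrib)
  then show ?thesis
    by (simp add: rough_laplacian_def L_def[symmetric] sum.distrib scaleR_sum_right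
        pairing.sum_left pairing.sum_right)
qed

text \<open>At a point where \<open>S\<close> is diagonal, the derivative of \<open>S\<^sup>r\<close> is given by divided differences of
  \<open>x\<^sup>r\<close> at the eigenvalues.\<close>

lemma nabla_perp_matrix_pow_diagonal:
  assumes S: "smooth_on V S" "q \<in> V" and diag: "S q = (\<chi> \<alpha> \<beta>. if \<alpha> = \<beta> then lam \<alpha> else 0)"
  shows "nabla_perp k (\<lambda>z. matrix_pow (S z) r) q $ \<alpha> $ \<beta> =
     (\<Sum>s<r. lam \<alpha> ^ s * lam \<beta> ^ (r - 1 - s)) * nabla_perp k S q $ \<alpha> $ \<beta>"
proof (induction r)
  case 0
  then show ?case by (simp add: nabla_perp_def d_const commutator_def)
next
  case (Suc r)
  have "nabla_perp k (\<lambda>z. matrix_pow (S z) (Suc r)) q $ \<alpha> $ \<beta> =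
     nabla_perp k S q $ \<alpha> $ \<beta> * lam \<beta> ^ r + lam \<alpha> * nabla_perp k (\<lambda>z. matrix_pow (S z) r) q $ \<alpha> $ \<beta>"
    unfolding nabla_perp_matrix_pow_Suc[OF S] matrix_pow_diagonal[OF diag]
    unfolding diag matrix_matrix_mult_def
    by (simp add: if_distrib[of "\<lambda>x. x * _"] if_distrib[of "\<lambda>x. _ * x"] cong: if_cong)
  also have "\<dots> = (lam \<beta> ^ r + (\<Sum>s<r. lam \<alpha> ^ Suc s * lam \<beta> ^ (r - 1 - s))) * nabla_perp k S q $ \<alpha> $ \<beta>"
    by (simp add: Suc.IH algebra_simps sum_distrib_left)
  also have "lam \<beta> ^ r + (\<Sum>s<r. lam \<alpha> ^ Suc s * lam \<beta> ^ (r - 1 - s)) =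
      (\<Sum>s<Suc r. lam \<alpha> ^ s * lam \<beta> ^ (Suc r - 1 - s))"
    by (subst sum.lessThan_Suc_shift) simp
  finally show ?case .
qed

lemma laplacian_trace_power:
  assumes q: "q \<in> V" and min: "\<And>z \<alpha>. z \<in> V \<Longrightarrow> trace (h z $ \<alpha>) = 0" and p: "p \<ge> 2"
  defines "S \<equiv> \<lambda>z. pairing (h z) (h z)"
  assumes diag: "\<And>\<alpha> \<beta>. S q $ \<alpha> $ \<beta> = (if \<alpha> = \<beta> then lam \<alpha> else 0)"
  shows "1 / (2 * real p) * frame_laplacian (\<lambda>z. trace (matrix_pow (S z) p)) q =
      1 / 2 * (\<Sum>(s, t) \<in> {(s, t). s + t = p - 2}. \<Sum>k\<in>UNIV. \<Sum>\<alpha>\<in>UNIV. \<Sum>\<beta>\<in>UNIV.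
                 lam \<alpha> ^ s * lam \<beta> ^ t * (nabla_perp k S q $ \<alpha> $ \<beta>)\<^sup>2)
    + (\<Sum>\<alpha>\<in>UNIV. lam \<alpha> ^ (p - 1) *
         (\<Sum>i\<in>UNIV. \<Sum>j\<in>UNIV. \<Sum>k\<in>UNIV. (nabla k h q $ \<alpha> $ i $ j)\<^sup>2))
    + real CARD('n) * trace (matrix_pow (S q) p) - trace (matrix_pow (S q) (p + 1))
    - (\<Sum>(\<alpha>, \<beta>) \<in> {(\<alpha>, \<beta>). \<beta> \<noteq> \<alpha>}.
         (norm (commutator (h q $ \<beta>) (h q $ \<alpha>)))\<^sup>2 * lam \<alpha> ^ (p - 1))"
proof -
  have smooth_S: "smooth_on V S"
    unfolding S_def by (rule smooth_pairing[OF smooth_h smooth_h])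
  have diag': "S q = (\<chi> \<alpha> \<beta>. if \<alpha> = \<beta> then lam \<alpha> else 0)"
    using diag by (simp add: vec_eq_iff)
  note pow = matrix_pow_diagonal[OF diag']
  have inner_h: "h q $ \<alpha> \<bullet> h q $ \<beta> = (if \<alpha> = \<beta> then lam \<alpha> else 0)" for \<alpha> \<beta>
    using diag[of \<alpha> \<beta>] by (simp add: S_def pairing_def)
  have D_sym: "nabla_perp k S q $ \<beta> $ \<alpha> = nabla_perp k S q $ \<alpha> $ \<beta>" for k \<alpha> \<beta>
    unfolding S_def nabla_perp_pairing[OF smooth_h smooth_h q] by (simp add: pairing_def inner_commute)
  have first: "(\<Sum>k\<in>UNIV. trace (nabla_perp k (\<lambda>z. matrix_pow (S z) (p - 1)) q ** nabla_perp k S q)) =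
     (\<Sum>(s, t) \<in> {(s, t). s + t = p - 2}. \<Sum>k\<in>UNIV. \<Sum>\<alpha>\<in>UNIV. \<Sum>\<beta>\<in>UNIV.
                 lam \<alpha> ^ s * lam \<beta> ^ t * (nabla_perp k S q $ \<alpha> $ \<beta>)\<^sup>2)"
  proof -
    have range: "{..<p - 1} = {..p - 2}" using p by auto
    have "(\<Sum>k\<in>UNIV. trace (nabla_perp k (\<lambda>z. matrix_pow (S z) (p - 1)) q ** nabla_perp k S q)) =
      (\<Sum>k\<in>UNIV. \<Sum>\<alpha>\<in>UNIV. \<Sum>\<beta>\<in>UNIV. \<Sum>s\<le>p - 2.
          lam \<alpha> ^ s * lam \<beta> ^ (p - 2 - s) * (nabla_perp k S q $ \<alpha> $ \<beta>)\<^sup>2)"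
      unfolding trace_def matrix_matrix_mult_def vec_lambda_beta
        nabla_perp_matrix_pow_diagonal[OF smooth_S q diag'] range
      by (intro sum.cong refl) (simp add: sum_distrib_right D_sym power2_eq_square mult.assoc numeral_2_eq_2)
    also have "\<dots> = (\<Sum>k\<in>UNIV. \<Sum>s\<le>p - 2. \<Sum>\<alpha>\<in>UNIV. \<Sum>\<beta>\<in>UNIV.
          lam \<alpha> ^ s * lam \<beta> ^ (p - 2 - s) * (nabla_perp k S q $ \<alpha> $ \<beta>)\<^sup>2)"
      by (intro sum.cong refl sum_rotate)
    also have "\<dots> = (\<Sum>s\<le>p - 2. \<Sum>k\<in>UNIV. \<Sum>\<alpha>\<in>UNIV. \<Sum>\<beta>\<in>UNIV.
          lam \<alpha> ^ s * lam \<beta> ^ (p - 2 - s) * (nabla_perp k S q $ \<alpha> $ \<beta>)\<^sup>2)"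
      by (rule sum.swap)
    finally show ?thesis
      unfolding sum_add_eq_pairs[of "\<lambda>s t. \<Sum>k\<in>UNIV. \<Sum>\<alpha>\<in>UNIV. \<Sum>\<beta>\<in>UNIV.
                 lam \<alpha> ^ s * lam \<beta> ^ t * (nabla_perp k S q $ \<alpha> $ \<beta>)\<^sup>2"] .
  qed
  have trace_pow: "trace (matrix_pow (S q) (p - 1) ** B) = (\<Sum>\<alpha>\<in>UNIV. lam \<alpha> ^ (p - 1) * B $ \<alpha> $ \<alpha>)" for B
    unfolding pow trace_def matrix_matrix_mult_def
    by (simp add: if_distrib[of "\<lambda>x. x * _"] cong: if_cong)
  have simons: "h q $ \<alpha> \<bullet> rough_laplacian h q $ \<alpha> = real CARD('n) * lam \<alpha> - lam \<alpha> ^ 2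
      - (\<Sum>\<beta>\<in>UNIV. (norm (commutator (h q $ \<beta>) (h q $ \<alpha>)))\<^sup>2)" for \<alpha>
  proof -
    have "transpose (h q $ \<beta>) = h q $ \<beta>" for \<beta>
      using h_sym[OF q] by (simp add: transpose_def vec_eq_iff)
    then show ?thesis
      by (simp add: simons_identity[OF q min] inner_diff_right inner_sum_right inner_double_commutator
          inner_h power2_eq_square if_distrib[of "\<lambda>x. x * _"] if_distrib[of "\<lambda>x. _ * x"] cong: if_cong)
  qed
  have grad: "(\<Sum>k\<in>UNIV. pairing (nabla k h q) (nabla k h q)) $ \<alpha> $ \<alpha> =
      (\<Sum>i\<in>UNIV. \<Sum>j\<in>UNIV. \<Sum>k\<in>UNIV. (nabla k h q $ \<alpha> $ i $ j)\<^sup>2)" for \<alpha>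
    by (simp add: pairing_def inner_vec_def power2_eq_square) (rule sum_rotate[symmetric])
  have second: "trace (matrix_pow (S q) (p - 1) **
        (\<Sum>k\<in>UNIV. nabla_perp k (nabla_perp k S) q - (\<Sum>j\<in>UNIV. t k q $ j $ k *\<^sub>R nabla_perp j S q))) =
     2 * (\<Sum>\<alpha>\<in>UNIV. lam \<alpha> ^ (p - 1) *
       ((real CARD('n) * lam \<alpha> - lam \<alpha> ^ 2 - (\<Sum>\<beta>\<in>UNIV. (norm (commutator (h q $ \<beta>) (h q $ \<alpha>)))\<^sup>2))
        + (\<Sum>i\<in>UNIV. \<Sum>j\<in>UNIV. \<Sum>k\<in>UNIV. (nabla k h q $ \<alpha> $ i $ j)\<^sup>2)))"
    unfolding laplacian_pairing_h[OF q, folded S_def] trace_pow sum_distrib_left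
  proof (intro sum.cong refl)
    fix \<alpha>
    have "(pairing (rough_laplacian h q) (h q) + pairing (h q) (rough_laplacian h q)
      + 2 *\<^sub>R (\<Sum>k\<in>UNIV. pairing (nabla k h q) (nabla k h q))) $ \<alpha> $ \<alpha>
      = 2 * (h q $ \<alpha> \<bullet> rough_laplacian h q $ \<alpha>
        + (\<Sum>k\<in>UNIV. pairing (nabla k h q) (nabla k h q)) $ \<alpha> $ \<alpha>)"
      by (simp only: vector_add_component vector_scaleR_component)
        (simp add: pairing_def inner_commute)
    then show "lam \<alpha> ^ (p - 1) * (pairing (rough_laplacian h q) (h q) + pairing (h q) (rough_laplacian h q)
      + 2 *\<^sub>R (\<Sum>k\<in>UNIV. pairing (nabla k h q) (nabla k h q))) $ \<alpha> $ \<alpha> =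
      2 * (lam \<alpha> ^ (p - 1) * ((real CARD('n) * lam \<alpha> - lam \<alpha> ^ 2 - (\<Sum>\<beta>\<in>UNIV. (norm (commutator (h q $ \<beta>) (h q $ \<alpha>)))\<^sup>2))
        + (\<Sum>i\<in>UNIV. \<Sum>j\<in>UNIV. \<Sum>k\<in>UNIV. (nabla k h q $ \<alpha> $ i $ j)\<^sup>2)))"
      by (simp only: simons grad)
  qed
  have tr: "trace (matrix_pow (S q) r) = (\<Sum>\<alpha>\<in>UNIV. lam \<alpha> ^ r)" for r
    by (simp add: pow trace_def)
  have powers: "lam \<alpha> ^ (p - 1) * lam \<alpha> = lam \<alpha> ^ p" "lam \<alpha> ^ (p - 1) * lam \<alpha> ^ 2 = lam \<alpha> ^ (p + 1)" for \<alpha>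
    using p by (cases p; simp add: power2_eq_square)+
  \<comment> \<open>A matrix commutes with itself, so the sum extends to all pairs.\<close>
  have comm: "(\<Sum>(\<alpha>, \<beta>) \<in> {(\<alpha>, \<beta>). \<beta> \<noteq> \<alpha>}.
         (norm (commutator (h q $ \<beta>) (h q $ \<alpha>)))\<^sup>2 * lam \<alpha> ^ (p - 1)) =
     (\<Sum>\<alpha>\<in>UNIV. lam \<alpha> ^ (p - 1) * (\<Sum>\<beta>\<in>UNIV. (norm (commutator (h q $ \<beta>) (h q $ \<alpha>)))\<^sup>2))"
  proof -
    have "(\<Sum>(\<alpha>, \<beta>) \<in> {(\<alpha>, \<beta>). \<beta> \<noteq> \<alpha>}.
         (norm (commutator (h q $ \<beta>) (h q $ \<alpha>)))\<^sup>2 * lam \<alpha> ^ (p - 1)) =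
      (\<Sum>(\<alpha>, \<beta>) \<in> UNIV. (norm (commutator (h q $ \<beta>) (h q $ \<alpha>)))\<^sup>2 * lam \<alpha> ^ (p - 1))"
      by (rule sum.mono_neutral_left) (auto simp: commutator_def)
    then show ?thesis
      by (simp add: sum_UNIV_pairs sum_distrib_left mult.commute)
  qed
  have last: "(\<Sum>\<alpha>\<in>UNIV. lam \<alpha> ^ (p - 1) *
       ((real CARD('n) * lam \<alpha> - lam \<alpha> ^ 2 - (\<Sum>\<beta>\<in>UNIV. (norm (commutator (h q $ \<beta>) (h q $ \<alpha>)))\<^sup>2))
        + (\<Sum>i\<in>UNIV. \<Sum>j\<in>UNIV. \<Sum>k\<in>UNIV. (nabla k h q $ \<alpha> $ i $ j)\<^sup>2))) =
     real CARD('n) * (\<Sum>\<alpha>\<in>UNIV. lam \<alpha> ^ p) - (\<Sum>\<alpha>\<in>UNIV. lam \<alpha> ^ (p + 1))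
     - (\<Sum>\<alpha>\<in>UNIV. lam \<alpha> ^ (p - 1) * (\<Sum>\<beta>\<in>UNIV. (norm (commutator (h q $ \<beta>) (h q $ \<alpha>)))\<^sup>2))
     + (\<Sum>\<alpha>\<in>UNIV. lam \<alpha> ^ (p - 1) *
         (\<Sum>i\<in>UNIV. \<Sum>j\<in>UNIV. \<Sum>k\<in>UNIV. (nabla k h q $ \<alpha> $ i $ j)\<^sup>2))"
    unfolding powers[symmetric]
    by (simp only: distrib_left right_diff_distrib sum.distrib sum_subtractf sum_distrib_left mult.left_commute)
  have half: "y = 1 / 2 * a + e + b - c - c'" if "y = 1 / 2 * (a + 2 * (b - c - c' + e))" for y a b c c' e :: real
    using that by simp
  have "1 / (2 * real p) * frame_laplacian (\<lambda>z. trace (matrix_pow (S z) p)) q = 1 / 2 *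
     ((\<Sum>k\<in>UNIV. trace (nabla_perp k (\<lambda>z. matrix_pow (S z) (p - 1)) q ** nabla_perp k S q))
     + trace (matrix_pow (S q) (p - 1) **
        (\<Sum>k\<in>UNIV. nabla_perp k (nabla_perp k S) q - (\<Sum>j\<in>UNIV. t k q $ j $ k *\<^sub>R nabla_perp j S q))))"
    unfolding frame_laplacian_trace_matrix_pow[OF smooth_S q] using p by simp
  then show ?thesis
    unfolding first second last tr comm by (rule half)
qed

end

section \<open>The Laplace--Beltrami operator in a moving frame\<close>

lemma frechet_derivative_axis:
  fixes f :: "real^'n \<Rightarrow> 'b::real_normed_vector"
  assumes "f differentiable at q"
  shows "frechet_derivative f (at q) v = (\<Sum>i\<in>UNIV. v $ i *\<^sub>R frechet_derivative f (at q) (axis i 1))"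
proof -
  interpret linear "frechet_derivative f (at q)" by (rule linear_frechet_derivative[OF assms])
  have "v = (\<Sum>i\<in>UNIV. v $ i *\<^sub>R axis i 1)"
    using basis_expansion[of v] by (simp add: scalar_mult_eq_scaleR)
  from arg_cong[OF this, of "frechet_derivative f (at q)"] show ?thesis by (simp add: sum scale)
qed

lemma second_derivative_axis:
  fixes f :: "real^'n \<Rightarrow> 'b::euclidean_space"
  assumes f: "smooth_on U f" and q: "q \<in> U"
  shows "frechet_derivative (\<lambda>z. frechet_derivative f (at z) v) (at q) w =
    (\<Sum>i\<in>UNIV. \<Sum>j\<in>UNIV. (w $ i * v $ j) *\<^sub>R partial i (partial j f) q)"
proof -
  have 1: "frechet_derivative (\<lambda>z. frechet_derivative f (at z) v) (at q) w =
     (\<Sum>i\<in>UNIV. w $ i *\<^sub>R frechet_derivative (\<lambda>z. frechet_derivative f (at z) v) (at q) (axis i 1))" for v w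
    by (rule frechet_derivative_axis[OF smooth_on_differentiable[OF smooth_on_frechet_derivative[OF f] q]])
  have 2: "frechet_derivative (\<lambda>z. frechet_derivative f (at z) v) (at q) (axis i 1) =
     (\<Sum>j\<in>UNIV. v $ j *\<^sub>R partial i (partial j f) q)" for i
    unfolding frechet_derivative_commute[OF f q, of v] 1[of "axis i 1" v] partial_def
    by (intro sum.cong refl arg_cong2[where f=scaleR] frechet_derivative_commute[OF f q])
  show ?thesis unfolding 1[of v w] 2 by (simp add: scaleR_sum_right)
qed

lemma smooth_on_partial: "smooth_on U f \<Longrightarrow> smooth_on U (partial i f)"
  unfolding partial_def by (rule smooth_on_frechet_derivative)

lemma partial_commute:
  fixes f :: "real^'n \<Rightarrow> 'b::euclidean_space"
  assumes "smooth_on U f" "q \<in> U"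
  shows "partial i (partial j f) q = partial j (partial i f) q"
  unfolding partial_def by (rule frechet_derivative_commute[OF assms])

text \<open>The derivatives of the metric cancel except for the tangential component of the second
  derivative of the immersion.\<close>

lemma christoffel_eq:
  fixes g :: "real^'n \<Rightarrow> 'e::euclidean_space"
  assumes g: "smooth_on U g" and q: "q \<in> U"
  shows "christoffel g k i j q =
     (\<Sum>l\<in>UNIV. matrix_inv (metric g q) $ k $ l * (partial i (partial j g) q \<bullet> partial l g q))"
proof -
  have m: "partial i (\<lambda>z. metric g z $ j $ l) q =
      partial j g q \<bullet> partial i (partial l g) q + partial i (partial j g) q \<bullet> partial l g q" for i j l
    using frechet_derivative_bilinear[OF bounded_bilinear_inner
        smooth_on_differentiable[OF smooth_on_partial[OF g] q]
        smooth_on_differentiable[OF smooth_on_partial[OF g] q], of j l "axis i 1"]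
    by (simp add: metric_def partial_def)
  have "partial i (\<lambda>z. metric g z $ j $ l) q + partial j (\<lambda>z. metric g z $ i $ l) q
         - partial l (\<lambda>z. metric g z $ i $ j) q = 2 * (partial i (partial j g) q \<bullet> partial l g q)" for l
    unfolding m partial_commute[OF g q, of l] partial_commute[OF g q, of j i] by (simp add: inner_commute)
  then show ?thesis
    unfolding christoffel_def by (simp add: sum_divide_distrib)
qed

context moving_frame
begin

lemma dg_X: "q \<in> V \<Longrightarrow> (\<Sum>i\<in>UNIV. X k q $ i *\<^sub>R partial i g q) = \<epsilon> (Inl k) q"
  using frechet_derivative_axis[OF smooth_on_differentiable[OF smooth_g], of q "X k q"] tangent
  by (simp add: partial_def)

text \<open>The frame is orthonormal for the induced metric, so the sum of the squares of its vectors is the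
  inverse metric.\<close>

lemma inverse_metric:
  assumes q: "q \<in> V"
  defines "M \<equiv> \<chi> a b. \<Sum>k\<in>UNIV. X k q $ a * X k q $ b"
  shows "M ** metric g q = mat 1" and "matrix_inv (metric g q) = M"
proof -
  have "(M ** metric g q) $ a $ c = mat 1 $ a $ c" for a c
  proof -
    have "(M ** metric g q) $ a $ c =
      (\<Sum>b\<in>UNIV. \<Sum>k\<in>UNIV. X k q $ a * (X k q $ b * (partial b g q \<bullet> partial c g q)))"
      by (simp add: M_def matrix_matrix_mult_def metric_def sum_distrib_right mult.assoc)
    also have "\<dots> = (\<Sum>k\<in>UNIV. X k q $ a * ((\<Sum>b\<in>UNIV. X k q $ b *\<^sub>R partial b g q) \<bullet> partial c g q))"
      by (subst sum.swap) (simp add: sum_distrib_left inner_sum_left)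
    also have "\<dots> = (\<Sum>k\<in>UNIV. (\<epsilon> (Inl k) q \<bullet> partial c g q) *\<^sub>R X k q) $ a"
      by (simp add: dg_X[OF q] mult.commute)
    also have "\<dots> = axis c 1 $ a"
      unfolding partial_def X_expand[OF q, of "axis c 1", symmetric] ..
    finally show ?thesis by (simp add: axis_def mat_def)
  qed
  then show *: "M ** metric g q = mat 1" by (simp add: vec_eq_iff)
  then have **: "metric g q ** M = mat 1" by (simp add: matrix_left_right_inverse)
  have "metric g q ** matrix_inv (metric g q) = mat 1"
    unfolding matrix_inv_def by (rule someI2[of _ M]) (use * ** in auto)
  then have "matrix_inv (metric g q) = M ** metric g q ** matrix_inv (metric g q)"
    by (simp add: *)
  also have "\<dots> = M"
    using \<open>metric g q ** matrix_inv (metric g q) = mat 1\<close> by (simp add: matrix_mul_assoc[symmetric])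
  finally show "matrix_inv (metric g q) = M" .
qed

text \<open>Contraction with the inverse metric evaluates the Hessian on the frame. The Christoffel term
  \<open>G k\<close> and the derivative \<open>W k\<close> of the field \<open>X k\<close> along itself add up to the tangential part of
  \<open>d\<^sub>k \<epsilon>\<^sub>k\<close>, which is \<open>\<nabla>\<^sub>k e\<^sub>k\<close>.\<close>

lemma laplace_beltrami_coordinates:
  assumes u: "smooth_on V u" and q: "q \<in> V"
  shows "(\<Sum>i\<in>UNIV. \<Sum>j\<in>UNIV. matrix_inv (metric g q) $ i $ j * hessian g u q $ i $ j) = frame_laplacian u q"
proof -
  interpret g: linear "frechet_derivative g (at q)" by (rule linear_dg[OF q])
  interpret u: linear "frechet_derivative u (at q)"
    by (rule linear_frechet_derivative[OF smooth_on_differentiable[OF u q]])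
  let ?M = "matrix_inv (metric g q)"
  define \<Gamma> where "\<Gamma> i j = (\<chi> k. christoffel g k i j q)" for i j
  define G where "G k = (\<Sum>i\<in>UNIV. \<Sum>j\<in>UNIV. (X k q $ i * X k q $ j) *\<^sub>R \<Gamma> i j)" for k
  define W where "W k = frechet_derivative (X k) (at q) (X k q)" for k
  have dg: "frechet_derivative g (at q) v = (\<Sum>i\<in>UNIV. v $ i *\<^sub>R partial i g q)" for v
    unfolding partial_def by (rule frechet_derivative_axis[OF smooth_on_differentiable[OF smooth_g q]])
  have du: "frechet_derivative u (at q) v = (\<Sum>i\<in>UNIV. v $ i * partial i u q)" for v
    unfolding partial_def using frechet_derivative_axis[OF smooth_on_differentiable[OF u q], of v] by simp
  have mc: "metric g q $ k $ c = partial k g q \<bullet> partial c g q" for k c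
    by (simp add: metric_def)
  have M_sym: "?M $ k $ l = ?M $ l $ k" for k l
    by (simp add: inverse_metric[OF q] mult.commute)
  have "frechet_derivative g (at q) (\<Gamma> i j) \<bullet> partial c g q = partial i (partial j g) q \<bullet> partial c g q" for i j c
  proof -
    have "frechet_derivative g (at q) (\<Gamma> i j) \<bullet> partial c g q =
      (\<Sum>k\<in>UNIV. \<Sum>l\<in>UNIV. (partial i (partial j g) q \<bullet> partial l g q) * (?M $ l $ k * metric g q $ k $ c))"
      unfolding dg \<Gamma>_def vec_lambda_beta christoffel_eq[OF smooth_g q] inner_sum_left
        inner_scaleR_left sum_distrib_right
    proof (intro sum.cong refl)
      fix k l
      show "?M $ k $ l * (partial i (partial j g) q \<bullet> partial l g q) * (partial k g q \<bullet> partial c g q) =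
        (partial i (partial j g) q \<bullet> partial l g q) * (?M $ l $ k * metric g q $ k $ c)"
        unfolding mc M_sym[of l k] by simp
    qed
    also have "\<dots> = (\<Sum>l\<in>UNIV. (partial i (partial j g) q \<bullet> partial l g q) * (?M ** metric g q) $ l $ c)"
      by (subst sum.swap) (simp add: matrix_matrix_mult_def sum_distrib_left)
    also have "\<dots> = partial i (partial j g) q \<bullet> partial c g q"
      using inverse_metric[OF q] by (simp add: mat_def if_distrib[of "\<lambda>x. _ * x"] cong: if_cong)
    finally show ?thesis .
  qed
  then have tan: "frechet_derivative g (at q) (\<Gamma> i j) \<bullet> \<epsilon> (Inl l) q = partial i (partial j g) q \<bullet> \<epsilon> (Inl l) q" for i j l
    by (simp add: dg_X[OF q, symmetric] inner_sum_right)
  have "\<epsilon> (Inl l) q \<bullet> frechet_derivative g (at q) (G k + W k) = t k q $ l $ k" for k l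
  proof -
    have "frechet_derivative g (at q) (G k) \<bullet> \<epsilon> (Inl l) q =
        (\<Sum>i\<in>UNIV. \<Sum>j\<in>UNIV. (X k q $ i * X k q $ j) *\<^sub>R partial i (partial j g) q) \<bullet> \<epsilon> (Inl l) q"
      by (simp add: G_def g.sum g.scale inner_sum_left tan)
    also have "\<dots> = (d k (d k g) q - frechet_derivative g (at q) (W k)) \<bullet> \<epsilon> (Inl l) q"
      by (simp add: d_d[OF smooth_g q] second_derivative_axis[OF smooth_g q] W_def)
    also have "d k (d k g) q = d k (\<epsilon> (Inl k)) q"
      by (rule d_cong[OF q d_g])
    finally show ?thesis
      by (simp add: t_def g.add inner_add_right inner_diff_left inner_diff_right inner_commute[of _ "\<epsilon> (Inl l) q"])
  qed
  note comp = this
  have GW: "G k + W k = (\<Sum>j\<in>UNIV. t k q $ j $ k *\<^sub>R X j q)" for k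
    by (subst X_expand[OF q, of "G k + W k"]) (simp only: comp)
  have "(\<Sum>i\<in>UNIV. \<Sum>j\<in>UNIV. ?M $ i $ j * hessian g u q $ i $ j) =
     (\<Sum>i\<in>UNIV. \<Sum>j\<in>UNIV. \<Sum>k\<in>UNIV. (X k q $ i * X k q $ j) *
        (partial i (partial j u) q - frechet_derivative u (at q) (\<Gamma> i j)))"
    by (simp add: inverse_metric(2)[OF q] hessian_def du \<Gamma>_def sum_distrib_right)
  also have "\<dots> = (\<Sum>k\<in>UNIV. \<Sum>i\<in>UNIV. \<Sum>j\<in>UNIV. (X k q $ i * X k q $ j) *
        (partial i (partial j u) q - frechet_derivative u (at q) (\<Gamma> i j)))"
    by (rule sum_rotate)
  also have "\<dots> = (\<Sum>k\<in>UNIV. d k (d k u) q - frechet_derivative u (at q) (W k) - frechet_derivative u (at q) (G k))"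
  proof (intro sum.cong refl)
    fix k
    have "(\<Sum>i\<in>UNIV. \<Sum>j\<in>UNIV. (X k q $ i * X k q $ j) * partial i (partial j u) q) =
        d k (d k u) q - frechet_derivative u (at q) (W k)"
      by (simp add: d_d[OF u q] second_derivative_axis[OF u q] W_def)
    then show "(\<Sum>i\<in>UNIV. \<Sum>j\<in>UNIV. (X k q $ i * X k q $ j) *
        (partial i (partial j u) q - frechet_derivative u (at q) (\<Gamma> i j))) =
       d k (d k u) q - frechet_derivative u (at q) (W k) - frechet_derivative u (at q) (G k)"
      by (simp add: right_diff_distrib sum_subtractf G_def u.sum u.scale)
  qed
  also have "\<dots> = (\<Sum>k\<in>UNIV. d k (d k u) q - frechet_derivative u (at q) (G k + W k))"
    by (simp add: u.add algebra_simps)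
  also have "\<dots> = frame_laplacian u q"
    unfolding GW by (simp add: frame_laplacian_def u.sum u.scale d_def)
  finally show ?thesis .
qed

end

section \<open>Connection forms of the sphere\<close>

text \<open>Differentiation along a great circle.\<close>

lemma derivative_tangent_to_sphere:
  fixes f :: "'e::euclidean_space \<Rightarrow> real"
  assumes W: "open W" "y \<in> W" and y: "y \<bullet> y = 1" and f: "f differentiable at y"
    and const: "\<And>z. z \<in> W \<Longrightarrow> z \<bullet> z = 1 \<Longrightarrow> f z = c" and Y: "Y \<bullet> y = 0"
  shows "frechet_derivative f (at y) Y = 0"
proof (cases "Y = 0")
  case False
  define v where "v = Y /\<^sub>R norm Y"
  have v: "v \<bullet> y = 0" "v \<bullet> v = 1" "Y = norm Y *\<^sub>R v"
    using Y False by (simp_all add: v_def dot_square_norm power2_eq_square)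
  define \<gamma> where "\<gamma> s = cos s *\<^sub>R y + sin s *\<^sub>R v" for s :: real
  have \<gamma>0: "\<gamma> 0 = y" by (simp add: \<gamma>_def)
  have unit: "\<gamma> s \<bullet> \<gamma> s = 1" for s
    using v y sin_cos_squared_add3[of s] by (simp add: \<gamma>_def inner_add_left inner_add_right inner_commute[of y v])
  have "(\<gamma> has_vector_derivative v) (at 0)"
    unfolding \<gamma>_def by (auto intro!: derivative_eq_intros)
  then have "(f \<circ> \<gamma> has_vector_derivative frechet_derivative f (at y) v) (at 0)"
    using f \<gamma>0 by (intro vector_derivative_diff_chain_within[of _ _ _ UNIV, simplified])
      (auto simp: frechet_derivative_works intro: has_derivative_at_withinI)
  moreover have "(f \<circ> \<gamma> has_vector_derivative 0) (at 0)"
  proof (rule has_vector_derivative_transform_within_open[where f="\<lambda>_. c" and S="\<gamma> -` W"])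
    have "continuous_on UNIV \<gamma>"
      unfolding \<gamma>_def by (intro continuous_intros)
    then show "open (\<gamma> -` W)"
      using W(1) by (simp add: open_vimage)
  qed (use W \<gamma>0 const unit in auto)
  ultimately have "frechet_derivative f (at y) v = 0"
    by (rule vector_derivative_unique_at)
  then show ?thesis
    using linear_scale[OF linear_frechet_derivative[OF f], of "norm Y" v] v(3) by simp
qed (use linear_0[OF linear_frechet_derivative[OF f]] in simp)

text \<open>Uniqueness of the Levi-Civita connection. The forms \<open>E A \<bullet> dE B\<close> satisfy the same structure
  equations and are skew, so the difference \<open>T A B C\<close> is skew in \<open>A\<close>, \<open>B\<close> and symmetric in \<open>B\<close>,
  \<open>C\<close>, and such a tensor vanishes.\<close>

lemma connection_forms_eq:
  fixes E :: "'k::finite \<Rightarrow> 'e::euclidean_space \<Rightarrow> 'e"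
  assumes E: "sphere_frame W E" and \<omega>: "connection_forms W E \<omega>" and y: "y \<in> W" "y \<bullet> y = 1"
  shows "\<omega> A B y (E C y) = E A y \<bullet> frechet_derivative (E B) (at y) (E C y)"
proof -
  have yS: "y \<in> W \<inter> sphere 0 1" using y by (simp add: norm_eq_1)
  have smooth: "smooth_on W (E A)" for A using E by (simp add: sphere_frame_def)
  have dE: "E A differentiable at y" for A by (rule smooth_on_differentiable[OF smooth y(1)])
  have tan: "E A y \<bullet> y = 0" for A using E yS by (auto simp: sphere_frame_def)
  have on: "E A z \<bullet> E B z = (if A = B then 1 else 0)" if "z \<in> W" "z \<bullet> z = 1" for A B z
    using E that by (auto simp: sphere_frame_def norm_eq_1)
  define T where "T A B C = \<omega> A B y (E C y) - E A y \<bullet> frechet_derivative (E B) (at y) (E C y)" for A B C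
  have skewE: "E A y \<bullet> frechet_derivative (E B) (at y) (E C y) =
      - (E B y \<bullet> frechet_derivative (E A) (at y) (E C y))" for A B C
    using derivative_tangent_to_sphere[OF smooth_on_open[OF smooth] y
        differentiable_bilinear[OF bounded_bilinear_inner dE[of A] dE[of B]] on tan[of C]]
    by (simp add: frechet_derivative_bilinear[OF bounded_bilinear_inner dE dE] inner_commute)
  have skew: "T A B C = - T B A C" for A B C
  proof -
    have "\<omega> A B y (E C y) = - \<omega> B A y (E C y)"
      using \<omega> yS tan[of C] unfolding connection_forms_def by blast
    then show ?thesis using skewE[of A B C] by (simp add: T_def)
  qed
  have sym: "T A B C = T A C B" for A B C
  proof -
    have "ext_deriv (coframe E A) y (E C y) (E B y) =
        - (\<Sum>D\<in>UNIV. wedge (\<omega> A D) (coframe E D) y (E C y) (E B y))"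
      using \<omega> yS tan unfolding connection_forms_def by blast
    also have "\<dots> = - (\<omega> A B y (E C y) - \<omega> A C y (E B y))"
      using on[OF y] by (simp add: wedge_def coframe_def sum_subtractf if_distrib[of "\<lambda>x. _ * x"] cong: if_cong)
    finally have "frechet_derivative (E A) (at y) (E C y) \<bullet> E B y - frechet_derivative (E A) (at y) (E B y) \<bullet> E C y =
        - (\<omega> A B y (E C y) - \<omega> A C y (E B y))"
      by (simp add: ext_deriv_def coframe_def frechet_derivative_linear[OF bounded_linear_inner_left dE])
    then show ?thesis
      using skewE[of A B C] skewE[of A C B] by (simp add: T_def inner_commute)
  qed
  have "T A B C = T A C B" by (rule sym)
  also have "\<dots> = - T C A B" by (rule skew)
  also have "\<dots> = - T C B A" by (simp add: sym[of C A])
  also have "\<dots> = T B C A" using skew[of C B A] by simp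
  also have "\<dots> = T B A C" by (rule sym)
  also have "\<dots> = - T A B C" by (rule skew)
  finally show ?thesis by (simp add: T_def)
qed

section \<open>From adapted frames to moving frames\<close>

text \<open>The point that needs an argument is the smoothness of the fields \<open>X k\<close>: they solve a linear
  system with smooth coefficients, the matrix \<open>\<Theta>\<close> of the differential of the immersion in terms of
  the frame.\<close>

lemma adapted_frame_moving_frame:
  fixes F :: "'p::t2_space \<Rightarrow> 'e::euclidean_space" and V :: "(real^'n) set"
    and E :: "'n + 'm::finite \<Rightarrow> 'e \<Rightarrow> 'e"
  assumes dim: "DIM('e) = CARD('n) + CARD('m) + 1" and M: "F ` M \<subseteq> sphere 0 1"
    and frame: "adapted_frame M F V \<phi> W E \<omega>"
  shows "moving_frame V (F \<circ> \<phi>) (\<lambda>A q. E A (F (\<phi> q)))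
    (\<lambda>k q. inv (frechet_derivative (F \<circ> \<phi>) (at q)) (E (Inl k) (F (\<phi> q))))"
proof -
  let ?g = "F \<circ> \<phi>"
  let ?X = "\<lambda>k q. inv (frechet_derivative ?g (at q)) (E (Inl k) (F (\<phi> q)))"
  have V: "open V" "\<phi> ` V \<subseteq> M" and smooth_g: "smooth_on V ?g"
    and inj: "\<And>q. q \<in> V \<Longrightarrow> inj (frechet_derivative ?g (at q))"
    and W: "F ` \<phi> ` V \<subseteq> W" and E: "sphere_frame W E"
    and range: "\<And>q i. q \<in> V \<Longrightarrow> E (Inl i) (F (\<phi> q)) \<in> range (frechet_derivative ?g (at q))"
    and normal: "\<And>q \<alpha> v. q \<in> V \<Longrightarrow> E (Inr \<alpha>) (F (\<phi> q)) \<bullet> frechet_derivative ?g (at q) v = 0"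
    using frame by (auto simp: adapted_frame_def local_param_def openin_subset dest: openin_imp_subset)
  have on_sphere: "F (\<phi> q) \<in> W \<inter> sphere 0 1" if "q \<in> V" for q
    using that V W M by blast
  have smooth_E: "smooth_on V (\<lambda>q. E A (F (\<phi> q)))" for A
    using smooth_on_compose[of W "E A" V ?g] E smooth_g W
    by (simp add: sphere_frame_def image_comp)
  have tangent: "frechet_derivative ?g (at q) (?X k q) = E (Inl k) (F (\<phi> q))" if "q \<in> V" for k q
    by (rule f_inv_into_f[OF range[OF that]])
  have orthonormal: "E A (F (\<phi> q)) \<bullet> E B (F (\<phi> q)) = (if A = B then 1 else 0)" if "q \<in> V" for A B q
    using E on_sphere[OF that] by (auto simp: sphere_frame_def)
  define \<Theta> where "\<Theta> q = (\<chi> i j. E (Inl i) (F (\<phi> q)) \<bullet> frechet_derivative ?g (at q) (axis j 1))" for q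
  have \<Theta>X: "\<Theta> q *v ?X k q = axis k 1" if "q \<in> V" for k q
  proof -
    have "(\<Theta> q *v ?X k q) $ i = E (Inl i) (F (\<phi> q)) \<bullet> frechet_derivative ?g (at q) (?X k q)" for i
      by (subst frechet_derivative_axis[OF smooth_on_differentiable[OF smooth_g that]])
        (simp add: \<Theta>_def matrix_vector_mult_def inner_sum_right mult.commute)
    then show ?thesis
      using orthonormal[OF that] tangent[OF that] by (simp add: vec_eq_iff axis_def)
  qed
  have det: "det (\<Theta> q) \<noteq> 0" if "q \<in> V" for q
  proof -
    have "(\<Theta> q ** (\<chi> j k. ?X k q $ j)) $ i $ k = (\<Theta> q *v ?X k q) $ i" for i k
      by (simp add: matrix_matrix_mult_def matrix_vector_mult_def)
    then have "\<Theta> q ** (\<chi> j k. ?X k q $ j) = mat 1"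
      unfolding \<Theta>X[OF that] by (simp add: vec_eq_iff mat_def axis_def)
    then show ?thesis
      by (metis invertible_det_nz invertible_right_inverse)
  qed
  have "smooth_on V (?X k)" for k
  proof (rule smooth_on_linear_system[OF V(1) _ _ det \<Theta>X])
    show "smooth_on V (\<lambda>z. \<Theta> z $ i $ j)" for i j
      unfolding \<Theta>_def vec_lambda_beta
      by (intro smooth_on_bilinear[OF bounded_bilinear_inner] smooth_E smooth_on_frechet_derivative smooth_g)
  qed (auto intro: smooth_on_const V)
  then show ?thesis
    using dim smooth_g smooth_E on_sphere orthonormal E tangent normal inj
    by unfold_locales (auto simp: norm_eq_1 sphere_frame_def)
qed

theorem mainTheorem6:
  fixes M :: "'p::t2_space set"
    and F :: "'p \<Rightarrow> 'e::euclidean_space"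
    and V :: "(real^'n) set"
    and \<phi> :: "real^'n \<Rightarrow> 'p"
    and W :: "'e set"
    and E :: "'n + 'm::finite \<Rightarrow> 'e \<Rightarrow> 'e"
    and \<omega> :: "'n + 'm \<Rightarrow> 'n + 'm \<Rightarrow> 'e \<Rightarrow> 'e \<Rightarrow> real"
    and lam :: "'m \<Rightarrow> real"
    and x :: 'p
    and p :: nat
  assumes "DIM('e) = CARD('n) + CARD('m) + 1"
    and "compact M"
    and "sphere_submanifold TYPE('n) M F"
    and "minimal TYPE('n) TYPE('m) M F"
    and "p \<ge> 2"
    and "x \<in> M"
    and "adapted_frame M F V \<phi> W E \<omega>"
    and "x \<in> \<phi> ` V"
    and "\<And>\<alpha> \<beta>. fund_matrix F E \<omega> x $ \<alpha> $ \<beta> = (if \<alpha> = \<beta> then lam \<alpha> else 0)"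
  shows "1 / (2 * real p) * laplace_beltrami F V \<phi> (fp F E \<omega> p) x =
      1 / 2 * (\<Sum>(s, t) \<in> {(s, t). s + t = p - 2}. \<Sum>k\<in>UNIV. \<Sum>\<alpha>\<in>UNIV. \<Sum>\<beta>\<in>UNIV.
                 lam \<alpha> ^ s * lam \<beta> ^ t * (cov_fund_matrix F V \<phi> E \<omega> k \<alpha> \<beta> x)\<^sup>2)
    + (\<Sum>\<alpha>\<in>UNIV. lam \<alpha> ^ (p - 1) *
         (\<Sum>i\<in>UNIV. \<Sum>j\<in>UNIV. \<Sum>k\<in>UNIV. (cov_sff F V \<phi> E \<omega> \<alpha> i j k x)\<^sup>2))
    + real CARD('n) * fp F E \<omega> p x - fp F E \<omega> (p + 1) x
    - (\<Sum>(\<alpha>, \<beta>) \<in> {(\<alpha>, \<beta>). \<beta> \<noteq> \<alpha>}.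
         (norm (commutator (shape_matrix F E \<omega> \<beta> x) (shape_matrix F E \<omega> \<alpha> x)))\<^sup>2 * lam \<alpha> ^ (p - 1))"
proof -
  note frame = assms(7)
  define g where "g = F \<circ> \<phi>"
  define \<epsilon> where "\<epsilon> = (\<lambda>A q. E A (F (\<phi> q)))"
  define X where "X = (\<lambda>k q. inv (frechet_derivative g (at q)) (E (Inl k) (F (\<phi> q))))"
  have FM: "F ` M \<subseteq> sphere 0 1" using assms(3) by (simp add: sphere_submanifold_def)
  interpret moving_frame V g \<epsilon> X
    unfolding g_def \<epsilon>_def X_def by (rule adapted_frame_moving_frame[OF assms(1) FM frame])
  obtain q where q: "q \<in> V" and x: "x = \<phi> q" using assms(8) by blast
  have inj: "inj_on \<phi> V"
    using frame unfolding adapted_frame_def local_param_def homeomorphism_def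
    by (metis inj_on_inverseI)
  have inv: "inv_into V \<phi> (\<phi> q) = q" by (rule inv_into_f_f[OF inj q])
  have \<omega>_eq: "\<omega> A B (F (\<phi> z)) (E (Inl k) (F (\<phi> z))) = \<epsilon> A z \<bullet> d k (\<epsilon> B) z" if z: "z \<in> V" for A B k z
  proof -
    have W: "sphere_frame W E" "connection_forms W E \<omega>" "F (\<phi> z) \<in> W"
      using frame z by (auto simp: adapted_frame_def)
    have "smooth_on W (E B)" using W(1) by (simp add: sphere_frame_def)
    then have "frechet_derivative (E B \<circ> g) (at z) =
        frechet_derivative (E B) (at (g z)) \<circ> frechet_derivative g (at z)"
      using smooth_on_differentiable[OF smooth_g z] smooth_on_differentiable[of W "E B" "g z"] W(3)
      by (intro frechet_derivative_compose) (auto simp: g_def)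
    moreover have "E B \<circ> g = \<epsilon> B"
      by (simp add: g_def \<epsilon>_def comp_def)
    ultimately have "d k (\<epsilon> B) z = frechet_derivative (E B) (at (F (\<phi> z))) (E (Inl k) (F (\<phi> z)))"
      using tangent[OF z, of k] by (simp add: d_def) (simp add: g_def \<epsilon>_def)
    moreover have "F (\<phi> z) \<bullet> F (\<phi> z) = 1"
      using g_unit[OF z] by (simp add: g_def)
    ultimately show ?thesis
      using connection_forms_eq[OF W] by (simp add: \<epsilon>_def)
  qed
  have sff: "sff F E \<omega> \<alpha> i j (\<phi> z) = h z $ \<alpha> $ i $ j" if "z \<in> V" for \<alpha> i j z
    by (simp add: sff_def h_def \<omega>_eq[OF that])
  have shape: "shape_matrix F E \<omega> \<alpha> (\<phi> z) = h z $ \<alpha>" if "z \<in> V" for \<alpha> z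
    by (simp add: shape_matrix_def sff[OF that] vec_eq_iff)
  have fund: "fund_matrix F E \<omega> (\<phi> z) = pairing (h z) (h z)" if "z \<in> V" for z
    by (simp add: fund_matrix_def pairing_def shape[OF that])
  have fp: "fp F E \<omega> r (\<phi> z) = trace (matrix_pow (pairing (h z) (h z)) r)" if "z \<in> V" for r z
    by (simp add: fp_def fund[OF that])
  have tdiff: "tdiff F V \<phi> u (\<phi> q) (E (Inl k) (F (\<phi> q))) = d k (u \<circ> \<phi>) q" for u k
    by (simp only: tdiff_def inv d_def Let_def) (simp only: X_def g_def)
  have smooth_S: "smooth_on V (\<lambda>z. pairing (h z) (h z))"
    by (rule smooth_pairing[OF smooth_h smooth_h])
  have cov_sff: "cov_sff F V \<phi> E \<omega> \<alpha> i j k x = nabla k h q $ \<alpha> $ i $ j" for \<alpha> i j k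
  proof -
    have "d k (sff F E \<omega> \<alpha> i j \<circ> \<phi>) q = d k h q $ \<alpha> $ i $ j"
      unfolding d_vec3[OF smooth_h q, symmetric] by (rule d_cong[OF q]) (simp add: sff)
    moreover have "(\<Sum>l\<in>UNIV. h q $ \<alpha> $ l $ j * t k q $ l $ i) = - (\<Sum>l\<in>UNIV. t k q $ i $ l * h q $ \<alpha> $ l $ j)"
      unfolding sum_negf[symmetric]
    proof (intro sum.cong refl)
      fix l show "h q $ \<alpha> $ l $ j * t k q $ l $ i = - (t k q $ i $ l * h q $ \<alpha> $ l $ j)"
        using t_skew[OF q, of k l i] by simp
    qed
    ultimately show ?thesis
      unfolding x cov_sff_def Let_def tdiff nabla_nth sff[OF q] \<omega>_eq[OF q]
      by (simp add: t_def \<nu>_def mult.commute)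
  qed
  have cov_fund: "cov_fund_matrix F V \<phi> E \<omega> k \<alpha> \<beta> x = nabla_perp k (\<lambda>z. pairing (h z) (h z)) q $ \<alpha> $ \<beta>" for k \<alpha> \<beta>
  proof -
    let ?S = "pairing (h q) (h q)"
    have "d k ((\<lambda>y. fund_matrix F E \<omega> y $ \<alpha> $ \<beta>) \<circ> \<phi>) q = d k (\<lambda>z. pairing (h z) (h z)) q $ \<alpha> $ \<beta>"
      unfolding d_vec2[OF smooth_S q, symmetric] by (rule d_cong[OF q]) (simp add: fund)
    moreover have "(\<Sum>\<gamma>\<in>UNIV. ?S $ \<alpha> $ \<gamma> * \<nu> k q $ \<gamma> $ \<beta>) = - (\<Sum>\<gamma>\<in>UNIV. \<nu> k q $ \<beta> $ \<gamma> * ?S $ \<alpha> $ \<gamma>)"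
      unfolding sum_negf[symmetric]
    proof (intro sum.cong refl)
      fix \<gamma> show "?S $ \<alpha> $ \<gamma> * \<nu> k q $ \<gamma> $ \<beta> = - (\<nu> k q $ \<beta> $ \<gamma> * ?S $ \<alpha> $ \<gamma>)"
        using \<nu>_skew[OF q, of k \<gamma> \<beta>] by simp
    qed
    ultimately show ?thesis
      unfolding x cov_fund_matrix_def Let_def tdiff nabla_perp_def fund[OF q] \<omega>_eq[OF q]
      by (simp add: commutator_def matrix_matrix_mult_def) (simp add: \<nu>_def)
  qed
  have min: "trace (h z $ \<alpha>) = 0" if "z \<in> V" for z \<alpha>
    using assms(4) frame that sff[OF that] unfolding minimal_def trace_def by (metis (no_types, lifting) imageI sum.cong)
  have lb: "laplace_beltrami F V \<phi> (fp F E \<omega> p) x = frame_laplacian (\<lambda>z. trace (matrix_pow (pairing (h z) (h z)) p)) q"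
  proof -
    let ?f = "\<lambda>z. trace (matrix_pow (pairing (h z) (h z)) p)"
    have "smooth_on V ?f"
      by (intro smooth_on_linear[OF bounded_linear_trace] smooth_matrix_pow smooth_S)
    then have smooth: "smooth_on V (fp F E \<omega> p \<circ> \<phi>)"
      by (rule smooth_on_cong) (simp add: fp)
    have d1: "d k (fp F E \<omega> p \<circ> \<phi>) z = d k ?f z" if "z \<in> V" for k z
      by (rule d_cong[OF that]) (simp add: fp)
    have d2: "d k (d k (fp F E \<omega> p \<circ> \<phi>)) q = d k (d k ?f) q" for k
      by (rule d_cong[OF q d1])
    have "laplace_beltrami F V \<phi> (fp F E \<omega> p) x = frame_laplacian (fp F E \<omega> p \<circ> \<phi>) q"
      unfolding x laplace_beltrami_def inv Let_def g_def[symmetric]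
      by (rule laplace_beltrami_coordinates[OF smooth q])
    then show ?thesis by (simp add: frame_laplacian_def d1[OF q] d2)
  qed
  show ?thesis
    unfolding lb cov_sff cov_fund
    unfolding x fp[OF q] shape[OF q]
    using laplacian_trace_power[OF q min assms(5)] assms(9)[unfolded x fund[OF q]] by blast
qed

end
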